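(* For every integer $t\ge 1$ with $t\ne 3,6$, there exists a $(6t,3,2)$-BIBD with an optimal weak nesting; specifically, it has a weak nesting $\phi:\mathcal{A}\to Y$ with $|Y|=7t$, and no weak nesting of a $(6t,3,2)$-BIBD has fewer than $7t$ points.
   Context: A $(v,k,\lambda)$-BIBD is a pair $(X,\mathcal{A})$ where $X$ is a set of $v$ points and $\mathcal{A}$ is a multiset of $k$-subsets of $X$ (blocks) such that every pair of distinct points lies in exactly $\lambda$ blocks. A partial $(w,k,\lambda)$-BIBD is defined in the same way on $w$ points, except that every pair lies in at most $\lambda$ blocks. Given a $(v,k,\lambda)$-BIBD $(X,\mathcal{A})$ and a set $Y\supseteq X$ with $|Y|=w$, a map $\phi:\mathcal{A}\to Y$ is a weak nesting if $\phi(A)\notin A$ for every block $A$ and the multiset $\{A\cup\{\phi(A)\}:A\in\mathcal{A}\}$ is a partial $(w,k+1,\lambda+1)$-BIBD on $Y$. A weak nesting is optimal if $w=|Y|$ is as small as possible. *)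

theory Defs
  imports Main
begin

text \<open>A design is given by a point set X and a list of blocks (a list models the
multiset of blocks while allowing a map defined on individual block occurrences,
indexed by list position).\<close>

definition pair_count :: "'a set list \<Rightarrow> 'a \<Rightarrow> 'a \<Rightarrow> nat" where
  "pair_count B x y = length (filter (\<lambda>b. x \<in> b \<and> y \<in> b) B)"

definition bibd :: "'a set \<Rightarrow> 'a set list \<Rightarrow> nat \<Rightarrow> nat \<Rightarrow> nat \<Rightarrow> bool" where
  "bibd X B v k lam \<longleftrightarrow> finite X \<and> card X = v \<and>
     (\<forall>b \<in> set B. b \<subseteq> X \<and> card b = k) \<and>
     (\<forall>x \<in> X. \<forall>y \<in> X. x \<noteq> y \<longrightarrow> pair_count B x y = lam)"

definition partial_bibd :: "'a set \<Rightarrow> 'a set list \<Rightarrow> nat \<Rightarrow> nat \<Rightarrow> nat \<Rightarrow> bool" where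
  "partial_bibd X B w k lam \<longleftrightarrow> finite X \<and> card X = w \<and>
     (\<forall>b \<in> set B. b \<subseteq> X \<and> card b = k) \<and>
     (\<forall>x \<in> X. \<forall>y \<in> X. x \<noteq> y \<longrightarrow> pair_count B x y \<le> lam)"

definition weak_nesting ::
  "'a set \<Rightarrow> 'a set list \<Rightarrow> nat \<Rightarrow> nat \<Rightarrow> 'a set \<Rightarrow> (nat \<Rightarrow> 'a) \<Rightarrow> bool" where
  "weak_nesting X B k lam Y phi \<longleftrightarrow> X \<subseteq> Y \<and> finite Y \<and>
     (\<forall>i < length B. phi i \<in> Y \<and> phi i \<notin> B ! i) \<and>
     partial_bibd Y (map (\<lambda>i. insert (phi i) (B ! i)) [0..<length B]) (card Y) (k + 1) (lam + 1)"

end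

theory Submission
  imports Defs "HOL-Library.Multiset" "HOL-Library.Tree" "HOL-Number_Theory.Cong"
begin

text \<open>
  The lower bound is a count of spokes, the pairs formed by a point of a block and the point at which
  the block is nested. There are \<open>3 b = 6 t (6 t - 1)\<close> spokes for the \<open>b\<close> blocks; a pair inside \<open>X\<close>
  can be a spoke only once, since it is already covered twice, and a pair between \<open>X\<close> and \<open>Y - X\<close> at
  most three times.

  For existence, designs on \<open>t\<close> groups of six points and one additional point each are built
  recursively. Write \<open>t = 4 m + u\<close> with \<open>m\<close> coprime to \<open>6\<close> and \<open>u \<le> m\<close>. The lines
  \<open>c \<mapsto> a + c b\<close> over the integers modulo \<open>m\<close>, for \<open>c = 0, \<dots>, 4\<close>, form a transversal design with five
  groups of size \<open>m\<close>; truncating the last group to \<open>u\<close> points leaves lines of size \<open>4\<close> and \<open>5\<close>. Every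
  line is filled with a nested group divisible design of type \<open>6^4\<close> or \<open>6^5\<close> (two explicit ingredients),
  every group with a nested design for \<open>m\<close> or \<open>u\<close>. The values \<open>t\<close> without such a representation come
  from explicit starters over the integers modulo \<open>6 t - 1\<close> with one fixed point: an orbit of
  triples of residues meets every residue three times, so it can be nested at one additional point.
\<close>

section \<open>Nested triple systems\<close>

text \<open>A quadruple \<open>(a, b, c, f)\<close> is a block \<open>{a, b, c}\<close> nested at \<open>f\<close>.\<close>

type_synonym 'p quad = "'p \<times> 'p \<times> 'p \<times> 'p"

text \<open>Pairs are listed in both orders: for distinct points the count at \<open>(x, y)\<close>
  is then the number of blocks joining \<open>x\<close> and \<open>y\<close>, and in the starters
  every difference occurs with both signs.\<close>

fun sides :: "'p quad \<Rightarrow> ('p \<times> 'p) list" where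
  "sides (a, b, c, f) = [(a, b), (b, a), (a, c), (c, a), (b, c), (c, b)]"

fun spokes :: "'p quad \<Rightarrow> ('p \<times> 'p) list" where
  "spokes (a, b, c, f) = [(a, f), (f, a), (b, f), (f, b), (c, f), (f, c)]"

fun map_quad :: "('p \<Rightarrow> 'q) \<Rightarrow> 'p quad \<Rightarrow> 'q quad" where
  "map_quad h (a, b, c, f) = (h a, h b, h c, h f)"

fun proper_quad :: "'p set \<Rightarrow> 'p set \<Rightarrow> 'p quad \<Rightarrow> bool" where
  "proper_quad X Y (a, b, c, f) \<longleftrightarrow> a \<in> X \<and> b \<in> X \<and> c \<in> X \<and> f \<in> Y \<and> distinct [a, b, c, f]"

abbreviation side_count :: "'p quad list \<Rightarrow> 'p \<Rightarrow> 'p \<Rightarrow> nat" where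
  "side_count L x y \<equiv> count_list (concat (map sides L)) (x, y)"

abbreviation spoke_count :: "'p quad list \<Rightarrow> 'p \<Rightarrow> 'p \<Rightarrow> nat" where
  "spoke_count L x y \<equiv> count_list (concat (map spokes L)) (x, y)"

text \<open>Two sides and at most one spoke inside \<open>X\<close>, no side and at most three
  spokes towards an additional point: either way at most three extended blocks contain the pair. Two
  additional points are never joined, since every spoke has an end in \<open>X\<close>.\<close>

definition nested :: "'p set \<Rightarrow> 'p set \<Rightarrow> 'p quad list \<Rightarrow> bool" where
  "nested X Y L \<longleftrightarrow> (\<forall>q \<in> set L. proper_quad X Y q) \<and>
     (\<forall>x \<in> X. \<forall>y \<in> X. x \<noteq> y \<longrightarrow> side_count L x y = 2 \<and> spoke_count L x y \<le> 1) \<and>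
     (\<forall>x \<in> X. \<forall>y \<in> Y - X. spoke_count L x y \<le> 3)"

section \<open>Transport of nested systems along injections\<close>

lemma sides_map_quad: "sides (map_quad h q) = map (map_prod h h) (sides q)"
  by (cases q) simp

lemma spokes_map_quad: "spokes (map_quad h q) = map (map_prod h h) (spokes q)"
  by (cases q) simp

lemma concat_sides_map_quad:
  "concat (map sides (map (map_quad h) L)) = map (map_prod h h) (concat (map sides L))"
  by (simp add: map_concat sides_map_quad comp_def)

lemma concat_spokes_map_quad:
  "concat (map spokes (map (map_quad h) L)) = map (map_prod h h) (concat (map spokes L))"
  by (simp add: map_concat spokes_map_quad comp_def)

lemma count_list_map_prod:
  assumes "inj_on h Y" "set P \<subseteq> Y \<times> Y" "x \<in> Y" "y \<in> Y"
  shows "count_list (map (map_prod h h) P) (h x, h y) = count_list P (x, y)"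
  using assms(2) by (induction P) (use assms(1,3,4) in \<open>auto dest: inj_onD\<close>)

lemma set_sides: "proper_quad X Y q \<Longrightarrow> set (sides q) \<subseteq> X \<times> X"
  by (cases q) auto

lemma set_spokes: "proper_quad X Y q \<Longrightarrow> X \<subseteq> Y \<Longrightarrow> set (spokes q) \<subseteq> X \<times> Y \<union> Y \<times> X"
  by (cases q) auto

lemma count_list_concat: "count_list (concat xss) v = (\<Sum>xs\<leftarrow>xss. count_list xs v)"
  by (induction xss) auto

lemma count_list_Cons: "count_list (x # xs) y = of_bool (x = y) + count_list xs y"
  by simp

lemma spoke_count_commute: "spoke_count L x y = spoke_count L y x"
proof -
  have "count_list (spokes q) (x, y) = count_list (spokes q) (y, x)" for q
    by (cases q) (simp add: count_list_Cons conj_commute del: count_list.simps(2))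
  then show ?thesis by (simp add: count_list_concat comp_def)
qed

lemma nested_map:
  assumes L: "nested X Y L" and XY: "X \<subseteq> Y" and h: "inj_on h Y"
  shows "nested (h ` X) (h ` Y) (map (map_quad h) L)"
proof -
  have q: "proper_quad X Y q" if "q \<in> set L" for q
    using L that by (simp add: nested_def)
  have "proper_quad (h ` X) (h ` Y) (map_quad h q)" if "q \<in> set L" for q
    using q[OF that] XY h by (cases q) (auto dest: inj_onD)
  moreover have "set (concat (map sides L)) \<subseteq> Y \<times> Y" "set (concat (map spokes L)) \<subseteq> Y \<times> Y"
    using q set_sides[of X Y] set_spokes[of X Y] XY by fastforce+
  note cnt = count_list_map_prod[OF h this(1)] count_list_map_prod[OF h this(2)]
  have "h ` Y - h ` X = h ` (Y - X)"
    using h XY by (simp add: inj_on_image_set_diff)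
  ultimately show ?thesis
    using L XY cnt unfolding nested_def concat_sides_map_quad concat_spokes_map_quad
    by (auto simp: subset_iff)
qed

text \<open>Only the cardinalities matter: a bijection from \<open>X\<close> to \<open>X'\<close>
  and one between the sets of additional points are glued to a bijection from \<open>Y\<close> to
  \<open>Y'\<close>.\<close>

lemma nested_transfer:
  assumes "nested X Y L" "X \<subseteq> Y" "finite Y" "X' \<subseteq> Y'" "finite Y'" "card X' = card X" "card Y' = card Y"
  shows "\<exists>L'. nested X' Y' L'"
proof -
  have "card (Y' - X') = card (Y - X)"
    using assms by (simp add: card_Diff_subset finite_subset)
  then obtain g where g: "bij_betw g (Y - X) (Y' - X')"
    using assms(3,5) finite_same_card_bij[of "Y - X" "Y' - X'"] by auto
  obtain f where f: "bij_betw f X X'"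
    using assms finite_same_card_bij[of X X'] finite_subset by metis
  define h where "h x = (if x \<in> X then f x else g x)" for x
  have hX: "bij_betw h X X'"
    using f by (subst bij_betw_cong[of X h f]) (auto simp: h_def)
  have "bij_betw h (Y - X) (Y' - X')"
    using g by (subst bij_betw_cong[of _ h g]) (auto simp: h_def)
  then have "bij_betw h (X \<union> (Y - X)) (X' \<union> (Y' - X'))"
    using hX by (intro bij_betw_combine) auto
  then have "bij_betw h Y Y'"
    using assms(2,4) by (simp add: Un_absorb1)
  then show ?thesis
    using nested_map[OF assms(1,2), of h] hX by (auto simp: bij_betw_def)
qed

text \<open>Levels 0 to 5 hold the six points of a group, level 6 its additional point. With points
  as products, the part of the design over a set of groups is again a product.\<close>

definition nestable :: "nat \<Rightarrow> bool" where
  "nestable t \<longleftrightarrow> (\<exists>L. nested ({..<t} \<times> {..<6::nat}) ({..<t} \<times> {..<7}) L)"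

lemma nestableI:
  assumes "nested X Y L" "X \<subseteq> Y" "finite Y" "card X = 6 * t" "card Y = 7 * t"
  shows "nestable t"
  unfolding nestable_def
  by (rule nested_transfer[OF assms(1-3)]) (use assms in auto)

lemma nestableD:
  assumes "nestable t" "X \<subseteq> Y" "finite Y" "card X = 6 * t" "card Y = 7 * t"
  shows "\<exists>L. nested X Y L"
proof -
  obtain L where "nested ({..<t} \<times> {..<6::nat}) ({..<t} \<times> {..<7}) L"
    using assms(1) nestable_def by blast
  then show ?thesis
    by (rule nested_transfer) (use assms in auto)
qed

section \<open>From nested systems to weak nestings\<close>

lemma pair_count_Cons: "pair_count (b # B) x y = of_bool (x \<in> b \<and> y \<in> b) + pair_count B x y"
  by (simp add: pair_count_def)

lemma count_sides:
  assumes "distinct [a, b, c, f]" "x \<noteq> y"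
  shows "count_list (sides (a, b, c, f)) (x, y) = of_bool (x \<in> {a, b, c} \<and> y \<in> {a, b, c})"
  using assms by (cases "x = a"; cases "x = b"; cases "x = c"; auto)

text \<open>The three sides and three spokes are the six pairs of the extended block, each listed
  once per order.\<close>

lemma count_sides_spokes:
  assumes "distinct [a, b, c, f]" "x \<noteq> y"
  shows "count_list (sides (a, b, c, f)) (x, y) + count_list (spokes (a, b, c, f)) (x, y) =
    of_bool (x \<in> {f, a, b, c} \<and> y \<in> {f, a, b, c})"
  using assms by (cases "x = a"; cases "x = b"; cases "x = c"; cases "x = f"; auto)

lemma pair_count_triples:
  assumes "\<forall>q \<in> set L. proper_quad X Y q" "x \<noteq> y"
  shows "pair_count (map (\<lambda>(a, b, c, f). {a, b, c}) L) x y = side_count L x y"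
  using assms(1)
proof (induction L)
  case (Cons q L)
  obtain a b c f where q: "q = (a, b, c, f)" by (cases q)
  have "count_list (sides q) (x, y) = of_bool (x \<in> {a, b, c} \<and> y \<in> {a, b, c})"
    unfolding q using Cons.prems assms(2) by (intro count_sides) (auto simp: q)
  with Cons q show ?case by (simp add: pair_count_Cons del: sides.simps)
qed (simp add: pair_count_def)

lemma pair_count_quads:
  assumes "\<forall>q \<in> set L. proper_quad X Y q" "x \<noteq> y"
  shows "pair_count (map (\<lambda>(a, b, c, f). {f, a, b, c}) L) x y = side_count L x y + spoke_count L x y"
  using assms(1)
proof (induction L)
  case (Cons q L)
  obtain a b c f where q: "q = (a, b, c, f)" by (cases q)
  have "count_list (sides q) (x, y) + count_list (spokes q) (x, y) =
      of_bool (x \<in> {f, a, b, c} \<and> y \<in> {f, a, b, c})"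
    unfolding q using Cons.prems assms(2) by (intro count_sides_spokes) (auto simp: q)
  with Cons q show ?case by (simp add: pair_count_Cons del: sides.simps spokes.simps)
qed (simp add: pair_count_def)

text \<open>The extended blocks cover a pair as often as it is a side or a spoke: at most 2 + 1
  times inside \<open>X\<close>, at most 0 + 3 times between \<open>X\<close> and an additional
  point, and never between two additional points.\<close>

lemma nested_weak_nesting:
  fixes L :: "'p quad list"
  assumes L: "nested X Y L" and XY: "X \<subseteq> Y" "finite Y"
  shows "\<exists>B phi. bibd X B (card X) 3 2 \<and> weak_nesting X B 3 2 Y phi"
proof -
  define B :: "'p set list" where "B = map (\<lambda>(a, b, c, f). {a, b, c}) L"
  define phi where "phi i = (case L ! i of (a, b, c, f) \<Rightarrow> f)" for i
  have q: "\<forall>q \<in> set L. proper_quad X Y q" and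
    XX: "\<And>x y. x \<in> X \<Longrightarrow> y \<in> X \<Longrightarrow> x \<noteq> y \<Longrightarrow> side_count L x y = 2 \<and> spoke_count L x y \<le> 1" and
    XI: "\<And>x y. x \<in> X \<Longrightarrow> y \<in> Y - X \<Longrightarrow> spoke_count L x y \<le> 3"
    using L by (auto simp: nested_def)
  have "b \<subseteq> X \<and> card b = 3" if "b \<in> set B" for b
    using q that by (fastforce simp: B_def)
  then have bibd: "bibd X B (card X) 3 2"
    using XX XY pair_count_triples[OF q] finite_subset by (auto simp: bibd_def B_def)
  have ext: "map (\<lambda>i. insert (phi i) (B ! i)) [0..<length B] = map (\<lambda>(a, b, c, f). {f, a, b, c}) L"
    by (rule nth_equalityI) (auto simp: B_def phi_def split: prod.splits)
  have "pair_count (map (\<lambda>(a, b, c, f). {f, a, b, c}) L) x y \<le> 3"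
    if "x \<in> Y" "y \<in> Y" "x \<noteq> y" for x y
  proof -
    have side0: "side_count L x y = 0" if "x \<notin> X \<or> y \<notin> X"
      using q that set_sides[of X Y] by (fastforce simp: count_list_0_iff)
    have spoke0: "spoke_count L x y = 0" if "x \<notin> X" "y \<notin> X"
      using q that XY set_spokes[of X Y] by (fastforce simp: count_list_0_iff)
    show ?thesis
      unfolding pair_count_quads[OF q \<open>x \<noteq> y\<close>]
      using that XX[of x y] XI[of x y] XI[of y x] side0 spoke0 spoke_count_commute[of L x y]
      by (cases "x \<in> X"; cases "y \<in> X") auto
  qed
  moreover have "b \<subseteq> Y \<and> card b = 4" if "b \<in> set (map (\<lambda>(a, b, c, f). {f, a, b, c}) L)" for b
    using q that XY by fastforce
  moreover have "phi i \<in> Y \<and> phi i \<notin> B ! i" if "i < length B" for i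
  proof -
    have "proper_quad X Y (L ! i)" using q that by (simp add: B_def)
    with that show ?thesis by (cases "L ! i") (auto simp: B_def phi_def)
  qed
  ultimately have "weak_nesting X B 3 2 Y phi"
    using XY unfolding weak_nesting_def ext by (auto simp: partial_bibd_def)
  with bibd show ?thesis by blast
qed

section \<open>The lower bound\<close>

lemma weak_nesting_card_ge:
  assumes bibd: "bibd X B (6 * t) 3 2" and nest: "weak_nesting X B 3 2 Y phi"
  shows "7 * t \<le> card Y"
proof (cases "t = 0")
  case False
  define n where "n = length B"
  define B' where "B' = map (\<lambda>i. insert (phi i) (B ! i)) [0..<n]"
  \<comment> \<open>Directed spokes: the number of blocks through \<open>x\<close> that are nested
    at \<open>y\<close>.\<close>
  define e where "e x y = card {i. i < n \<and> x \<in> B ! i \<and> phi i = y}" for x y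
  have X: "finite X" "card X = 6 * t" and sub: "X \<subseteq> Y" and Y: "finite Y"
    using bibd nest by (auto simp: bibd_def weak_nesting_def)
  have blk: "B ! i \<subseteq> X" "card (B ! i) = 3" if "i < n" for i
    using bibd that by (auto simp: bibd_def n_def)
  have phi: "phi i \<in> Y" "phi i \<notin> B ! i" if "i < n" for i
    using nest that by (auto simp: weak_nesting_def n_def)
  have pc: "pair_count B x y = card {i. i < n \<and> x \<in> B ! i \<and> y \<in> B ! i}" for x y
    by (simp add: pair_count_def length_filter_conv_card n_def)
  have pc': "pair_count B' x y = card {i. i < n \<and> x \<in> insert (phi i) (B ! i) \<and> y \<in> insert (phi i) (B ! i)}"
    for x y
    by (simp add: pair_count_def length_filter_conv_card B'_def cong: conj_cong)
  have two: "card {i. i < n \<and> x \<in> B ! i \<and> y \<in> B ! i} = 2" if "x \<in> X" "y \<in> X" "x \<noteq> y" for x y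
    using bibd that by (simp add: bibd_def flip: pc)
  have three: "card {i. i < n \<and> x \<in> insert (phi i) (B ! i) \<and> y \<in> insert (phi i) (B ! i)} \<le> 3"
    if "x \<in> Y" "y \<in> Y" "x \<noteq> y" for x y
  proof -
    have "pair_count B' x y \<le> 3"
      using nest that by (simp add: weak_nesting_def partial_bibd_def B'_def n_def)
    then show ?thesis by (simp only: pc')
  qed
  have inner: "e x y + e y x \<le> 1" if "x \<in> X" "y \<in> X" "x \<noteq> y" for x y
  proof -
    let ?A = "{i. i < n \<and> x \<in> B ! i \<and> y \<in> B ! i}"
    let ?C = "{i. i < n \<and> x \<in> B ! i \<and> phi i = y}" and ?D = "{i. i < n \<and> y \<in> B ! i \<and> phi i = x}"
    \<comment> \<open>The three index sets are pairwise disjoint because no block contains the point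
      at which it is nested.\<close>
    have "card ?A + (card ?C + card ?D) = card (?A \<union> (?C \<union> ?D))"
      using phi by (subst card_Un_disjoint, simp, simp, blast, subst card_Un_disjoint) auto
    also have "\<dots> \<le> card {i. i < n \<and> x \<in> insert (phi i) (B ! i) \<and> y \<in> insert (phi i) (B ! i)}"
      by (rule card_mono) auto
    also have "\<dots> \<le> 3" using three that sub by blast
    finally show ?thesis using two[OF that] by (simp add: e_def)
  qed
  have outer: "e x y \<le> 3" if "x \<in> X" "y \<in> Y - X" for x y
  proof -
    have "e x y \<le> card {i. i < n \<and> x \<in> insert (phi i) (B ! i) \<and> y \<in> insert (phi i) (B ! i)}"
      unfolding e_def by (rule card_mono) auto
    also have "\<dots> \<le> 3" using three[of x y] that sub by blast
    finally show ?thesis .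
  qed
  have diag: "e x x = 0" for x
    using phi by (auto simp: e_def)
  have incidences: "(\<Sum>x\<in>X. card {i. i < n \<and> x \<in> B ! i}) = 3 * n"
  proof -
    have "(\<Sum>x\<in>X. card {i. i < n \<and> x \<in> B ! i}) = (\<Sum>x\<in>X. \<Sum>i<n. of_bool (x \<in> B ! i))"
      by (intro sum.cong refl) (simp add: Int_def)
    also have "\<dots> = (\<Sum>i<n. \<Sum>x\<in>X. of_bool (x \<in> B ! i))" by (rule sum.swap)
    also have "\<dots> = (\<Sum>i<n. card (X \<inter> B ! i))" using X by (simp add: Int_def)
    also have "\<dots> = (\<Sum>i<n. 3)"
      using blk by (intro sum.cong refl) (simp add: Int_absorb1)
    finally show ?thesis by simp
  qed
  \<comment> \<open>Ordered pairs of distinct points in a common block, counted twice: six per block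
    here, two blocks per pair below. This determines the number of blocks.\<close>
  have "(\<Sum>x\<in>X. \<Sum>y\<in>X - {x}. card {i. i < n \<and> x \<in> B ! i \<and> y \<in> B ! i}) = 6 * n"
  proof -
    have "(\<Sum>x\<in>X. \<Sum>y\<in>X - {x}. card {i. i < n \<and> x \<in> B ! i \<and> y \<in> B ! i}) =
        (\<Sum>x\<in>X. \<Sum>y\<in>X - {x}. \<Sum>i<n. of_bool (x \<in> B ! i \<and> y \<in> B ! i))"
      by (intro sum.cong refl) (simp add: Int_def)
    also have "\<dots> = (\<Sum>i<n. \<Sum>x\<in>X. \<Sum>y\<in>X - {x}. of_bool (x \<in> B ! i \<and> y \<in> B ! i))"
      by (simp only: sum.swap[where B = "{..<n}"])
    also have "\<dots> = (\<Sum>i<n. 6)"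
    proof (intro sum.cong refl)
      fix i assume "i \<in> {..<n}"
      then have i: "i < n" by simp
      have "(\<Sum>x\<in>X. \<Sum>y\<in>X - {x}. of_bool (x \<in> B ! i \<and> y \<in> B ! i)) =
          (\<Sum>x\<in>X. if x \<in> B ! i then 2 else (0::nat))"
      proof (intro sum.cong refl)
        fix x assume "x \<in> X"
        have "(\<Sum>y\<in>X - {x}. of_bool (y \<in> B ! i) :: nat) = card ((X - {x}) \<inter> B ! i)"
          using X by (simp add: Int_def)
        also have "(X - {x}) \<inter> B ! i = B ! i - {x}" using blk[OF i] by auto
        finally show "(\<Sum>y\<in>X - {x}. of_bool (x \<in> B ! i \<and> y \<in> B ! i)) = (if x \<in> B ! i then 2 else (0::nat))"
          using blk[OF i] by auto
      qed
      also have "\<dots> = 2 * card (X \<inter> B ! i)" using X by (simp add: sum.If_cases)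
      also have "X \<inter> B ! i = B ! i" using blk[OF i] by auto
      finally show "(\<Sum>x\<in>X. \<Sum>y\<in>X - {x}. of_bool (x \<in> B ! i \<and> y \<in> B ! i)) = (6::nat)"
        using blk[OF i] by simp
    qed
    finally show ?thesis by simp
  qed
  moreover have "(\<Sum>x\<in>X. \<Sum>y\<in>X - {x}. card {i. i < n \<and> x \<in> B ! i \<and> y \<in> B ! i}) = 6 * t * ((6 * t - 1) * 2)"
  proof -
    have "(\<Sum>y\<in>X - {x}. card {i. i < n \<and> x \<in> B ! i \<and> y \<in> B ! i}) = (\<Sum>y\<in>X - {x}. 2)"
      if "x \<in> X" for x
      by (intro sum.cong refl two) (use that in auto)
    then show ?thesis using X by simp
  qed
  ultimately have n: "6 * n = 6 * t * ((6 * t - 1) * 2)" by simp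
  \<comment> \<open>Every incidence of a point with a block is one spoke.\<close>
  have "(\<Sum>x\<in>X. \<Sum>y\<in>Y. e x y) = 3 * n"
  proof -
    have "(\<Sum>y\<in>Y. e x y) = card {i. i < n \<and> x \<in> B ! i}" for x
    proof -
      have "(\<Sum>y\<in>Y. e x y) = card (\<Union>y\<in>Y. {i. i < n \<and> x \<in> B ! i \<and> phi i = y})"
        unfolding e_def using Y by (subst card_UN_disjoint) auto
      also have "(\<Union>y\<in>Y. {i. i < n \<and> x \<in> B ! i \<and> phi i = y}) = {i. i < n \<and> x \<in> B ! i}"
        using phi by auto
      finally show ?thesis .
    qed
    then show ?thesis using incidences by simp
  qed
  moreover have "(\<Sum>x\<in>X. \<Sum>y\<in>Y. e x y) = (\<Sum>x\<in>X. \<Sum>y\<in>X. e x y) + (\<Sum>x\<in>X. \<Sum>y\<in>Y - X. e x y)"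
    by (simp add: sum.subset_diff[OF sub Y] sum.distrib)
  moreover have "(\<Sum>x\<in>X. \<Sum>y\<in>Y - X. e x y) \<le> (\<Sum>x\<in>X. \<Sum>y\<in>Y - X. 3)"
    using outer by (intro sum_mono)
  \<comment> \<open>Doubling the sum pairs \<open>e x y\<close> with \<open>e y x\<close>, to which
    \<open>inner\<close> applies off the diagonal.\<close>
  moreover have "(\<Sum>x\<in>X. \<Sum>y\<in>X. e x y) + (\<Sum>x\<in>X. \<Sum>y\<in>X. e x y) \<le> 6 * t * (6 * t - 1)"
  proof -
    have "(\<Sum>x\<in>X. \<Sum>y\<in>X. e x y) + (\<Sum>x\<in>X. \<Sum>y\<in>X. e x y) = (\<Sum>x\<in>X. \<Sum>y\<in>X. e x y + e y x)"
      by (simp add: sum.distrib sum.swap[of "\<lambda>x y. e y x"])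
    also have "\<dots> = (\<Sum>x\<in>X. \<Sum>y\<in>X - {x}. e x y + e y x)"
      by (rule sum.cong[OF refl], rule sum.mono_neutral_right) (use X diag in auto)
    also have "\<dots> \<le> (\<Sum>x\<in>X. \<Sum>y\<in>X - {x}. 1)"
      using inner by (intro sum_mono) auto
    also have "\<dots> = 6 * t * (6 * t - 1)" using X by simp
    finally show ?thesis .
  qed
  moreover have "card (Y - X) = card Y - 6 * t"
    using X sub by (simp add: card_Diff_subset)
  ultimately have "6 * t * ((6 * t - 1) * 2) \<le> 6 * t * (6 * t - 1) + 6 * t * (6 * (card Y - 6 * t))"
    using n X by (simp add: algebra_simps)
  then have "6 * t * (6 * t - 1) \<le> 6 * t * (6 * (card Y - 6 * t))"
    by (simp add: algebra_simps)
  \<comment> \<open>Integrality makes up for the missing 1: a multiple of 6 that is at least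
    \<open>6 * t - 1\<close> is at least \<open>6 * t\<close>.\<close>
  then have "6 * t - 1 \<le> 6 * (card Y - 6 * t)"
    using False by simp
  moreover have "6 * t \<le> card Y"
    using X sub Y card_mono by metis
  ultimately show ?thesis by arith
qed simp

section \<open>Cyclic starters\<close>

text \<open>A sorting algorithm suited to evaluation by the simplifier: branching by pattern matching on the
  truth value avoids the renormalisation of large subterms caused by an if-then-else.\<close>

function (sequential) tree_insert :: "'a::linorder \<Rightarrow> 'a tree \<Rightarrow> 'a tree"
  and tree_insert_at :: "bool \<Rightarrow> 'a \<Rightarrow> 'a tree \<Rightarrow> 'a \<Rightarrow> 'a tree \<Rightarrow> 'a tree" where
  "tree_insert x Leaf = Node Leaf x Leaf" |
  "tree_insert x (Node l y r) = tree_insert_at (x \<le> y) x l y r" |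
  "tree_insert_at True x l y r = Node (tree_insert x l) y r" |
  "tree_insert_at False x l y r = Node l y (tree_insert x r)"
  by pat_completeness auto
termination
  \<comment> \<open>The helper call gets an odd value, below that of the node it comes from and
    above those of both subtrees.\<close>
  by (relation "measure (case_sum (\<lambda>(x, t). 2 * size t) (\<lambda>(b, x, l, y, r). 2 * (size l + size r) + 1))") auto

definition tree_sort :: "'a::linorder list \<Rightarrow> 'a list" where
  "tree_sort xs = inorder2 (fold tree_insert xs Leaf) []"

lemma mset_tree_insert:
  "mset (inorder (tree_insert x t)) = add_mset x (mset (inorder t))"
  "mset (inorder (tree_insert_at c x l y r)) = {#x, y#} + mset (inorder l) + mset (inorder r)"
  by (induction x t and c x l y r rule: tree_insert_tree_insert_at.induct) auto

lemma mset_tree_sort: "mset (tree_sort xs) = mset xs"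
proof -
  have "mset (inorder (fold tree_insert xs t)) = mset xs + mset (inorder t)" for t
    by (induction xs arbitrary: t) (auto simp: mset_tree_insert)
  then show ?thesis by (simp add: tree_sort_def inorder2_inorder)
qed

lemma count_list_tree_sort: "count_list (tree_sort xs) v = count_list xs v"
  by (metis count_mset mset_tree_sort)

lemma set_tree_sort: "set (tree_sort xs) = set xs"
  by (metis mset_tree_sort set_mset_mset)

lemma count_list_replicate: "count_list (replicate n x) v = (if x = v then n else 0)"
  by (induction n) auto

text \<open>Reads multiplicities off the expected sorted lists in the checks below.\<close>

lemma count_list_replicate_upto:
  "count_list (concat (map (\<lambda>q. replicate (k q) q) [a..b::int])) v = (if a \<le> v \<and> v \<le> b then k v else 0)"
proof -
  have "count_list (concat (map (\<lambda>q. replicate (k q) q) [a..b])) v = (\<Sum>q\<leftarrow>[a..b]. if q = v then k q else 0)"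
    by (simp add: count_list_concat comp_def count_list_replicate)
  also have "\<dots> = (\<Sum>q\<in>{a..b}. if q = v then k q else 0)"
    by (subst sum_list_distinct_conv_sum_set) auto
  also have "\<dots> = (if a \<le> v \<and> v \<le> b then k v else 0)"
    by (simp add: sum.delta)
  finally show ?thesis .
qed

lemma count_list_upto: "count_list [a..b::int] v = of_bool (a \<le> v \<and> v \<le> b)"
  using count_list_replicate_upto[of "\<lambda>_. 1" a b v] by simp

text \<open>Points are integers: the nonnegative ones are residues modulo \<open>N\<close>, the negative ones are fixed
  points. Under development modulo \<open>N\<close> the orbit of an ordered pair of points is determined by
  \<open>diff_key\<close>: differences lie in \<open>{0..<N}\<close>, a fixed second point is its own key, a fixed first
  point gives a key above \<open>N\<close>, and \<open>N\<close> stands for two fixed points.\<close>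

definition diff_key :: "int \<Rightarrow> int \<times> int \<Rightarrow> int" where
  "diff_key N = (\<lambda>(p, q). if p < 0 then (if q < 0 then N else N - p)
                      else if q < 0 then q else (p - q) mod N)"

text \<open>With \<open>N = 6 t - 1\<close>, the point \<open>-1\<close> completes the residues to the \<open>6 t\<close> points of the design, and
  \<open>-2, \<dots>, -1 - t\<close> are the \<open>t\<close> additional points. In a starter \<open>(K, (a, b), T)\<close> the blocks
  \<open>{-1, a, b}\<close> and those in \<open>K\<close> are nested at \<open>0\<close>, and each \<open>(b, c)\<close> in \<open>T\<close> stands for the block
  \<open>{0, b, c}\<close> nested at an additional point of its own.\<close>

type_synonym starter = "(int \<times> int \<times> int) list \<times> (int \<times> int) \<times> (int \<times> int) list"

fun starter_quads :: "starter \<Rightarrow> int quad list" where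
  "starter_quads (K, (a, b), T) =
     (-1, a, b, 0) # map (\<lambda>(a, b, c). (a, b, c, 0)) K @
     map (\<lambda>(j, b, c). (0, b, c, j)) (zip [-1 - int (length T)..-2] T)"

text \<open>The key \<open>6 * t\<close> is that of a pair with first point -1, and
  \<open>6 * t + 1\<close> to \<open>7 * t\<close> belong to first points -2 to
  \<open>-1 - t\<close>. The expected lists omit the keys 0 and \<open>N\<close>, which excludes
  repeated points and pairs of fixed points. All bounds on spokes are attained: once inside
  \<open>X\<close>, three times towards each additional point.\<close>

definition quads_ok :: "int \<Rightarrow> int quad list \<Rightarrow> bool" where
  "quads_ok t Q \<longleftrightarrow>
     list_all (\<lambda>(a, b, c, f). -1 \<le> a \<and> -1 \<le> b \<and> -1 \<le> c \<and> -1 - t \<le> f) Q \<and>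
     tree_sort (map (diff_key (6 * t - 1)) (concat (map sides Q))) =
       concat (map (replicate 2) ([-1] @ [1..6 * t - 2] @ [6 * t])) \<and>
     tree_sort (map (diff_key (6 * t - 1)) (concat (map spokes Q))) =
       concat (map (replicate 3) [-1 - t..-2]) @ [-1] @ [1..6 * t - 2] @ [6 * t] @
       concat (map (replicate 3) [6 * t + 1..7 * t])"

definition starter_ok :: "starter \<Rightarrow> bool" where
  "starter_ok S \<longleftrightarrow> quads_ok (int (length (snd (snd S)))) (starter_quads S)"

text \<open>Found by computer search (hill climbing).\<close>

definition starters :: "starter list" where
  "starters = [([], (1,2), [(2,4)]),
   ([(1,4,2)], (8,6), [(4,7), (1,6)]),
   ([(5,1,7), (2,14,13)], (8,6), [(3,12), (7,8), (7,4)]),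
   ([(19,1,8), (5,2,20), (13,12,6)], (9,7), [(11,21), (9,19), (4,1), (6,15)]),
   ([(25,5,26), (12,9,16), (14,1,19), (18,8,2)], (6,7), [(8,5), (4,22), (6,20), (2,14), (10,27)]),
   ([(7,24,22), (19,12,15), (5,14,17), (9,2,8), (31,32,6)], (25,1), [(13,29), (14,19), (13,21),
     (12,17), (15,11), (8,33)]),
   ([(24,9,6), (21,30,14), (5,25,18), (1,22,28), (37,31,7), (2,29,33)], (3,15), [(5,1), (2,17),
     (8,9), (12,10), (19,8), (16,38), (18,13)]),
   ([(25,17,31), (35,11,1), (5,26,27), (6,23,9), (13,8,14), (44,18,7), (43,28,15)], (10,2),
     [(9,2), (17,44), (16,12), (18,20), (19,12), (4,22), (15,24), (16,11)]),
   ([(12,2,32), (7,25,14), (15,5,34), (36,42,30), (8,37,29), (40,6,1), (18,20,22), (10,49,9)],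
     (27,50), [(26,1), (22,37), (11,48), (9,36), (15,18), (17,20), (12,4), (25,46), (22,9)]),
   ([(15,2,36), (29,42,25), (14,7,8), (46,5,48), (1,12,56), (55,32,22), (33,35,38), (40,43,9),
     (6,49,18)], (31,39), [(14,38), (20,39), (12,52), (10,11), (29,24), (18,9), (27,44), (14,36),
     (27,53), (22,30)]),
   ([(56,8,33), (12,6,1), (62,61,43), (5,49,41), (45,10,37), (54,34,15), (42,46,29), (39,48,18),
     (51,2,52), (7,44,38)], (40,35), [(10,38), (24,15), (18,52), (12,16), (26,33), (3,54), (22,36),
     (3,10), (22,24), (12,32), (25,23)]),
   ([(48,55,11), (2,7,30), (35,19,13), (12,14,1), (44,45,18), (29,47,67), (54,68,33), (5,15,50),
     (43,51,61), (63,34,40), (6,25,9)], (39,22), [(15,24), (19,39), (31,69), (7,46), (28,4),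
     (25,13), (9,68), (15,49), (11,41), (21,63), (14,31), (4,70)]),
   ([(59,33,29), (49,64,7), (37,55,56), (50,39,60), (5,47,14), (2,57,73), (10,46,36), (53,45,66),
     (6,54,25), (9,74,8), (58,35,15), (51,34,12)], (61,1), [(34,2), (3,6), (33,72), (16,62), (7,47),
     (27,4), (32,8), (14,63), (24,49), (7,2), (31,13), (27,68), (12,37)]),
   ([(76,23,34), (51,29,31), (38,41,5), (1,72,6), (56,80,20), (71,14,57), (44,36,65), (43,28,24),
     (22,81,19), (46,68,48), (13,79,50), (67,9,73), (17,62,30)], (75,25), [(6,31), (10,52), (1,9),
     (34,60), (10,9), (13,48), (27,45), (30,76), (39,51), (39,67), (16,11), (28,43), (34,7),
     (4,18)]),
   ([(70,62,57), (85,25,8), (63,49,24), (78,2,30), (15,46,5), (52,61,42), (72,55,35), (45,51,66),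
     (1,83,50), (36,21,9), (86,77,75), (18,58,56), (69,22,73), (41,10,76)], (60,7), [(44,88),
     (34,66), (24,67), (3,11), (6,71), (14,30), (43,82), (26,30), (3,60), (25,88), (22,69), (19,52),
     (34,61), (18,54), (16,21)]),
   ([(79,25,67), (75,18,6), (62,2,42), (11,78,68), (43,46,7), (48,91,19), (1,45,85), (55,39,12),
     (64,81,71), (5,82,35), (44,9,8), (30,36,69), (61,54,37), (29,63,74), (92,15,73)], (38,23),
     [(44,67), (13,9), (15,63), (42,21), (46,20), (4,93), (27,64), (22,93), (14,33), (14,30),
     (22,9), (3,90), (31,94), (46,54), (29,34), (25,50)]),
   ([(60,22,80), (66,38,7), (96,11,4), (2,25,61), (64,75,58), (15,34,33), (72,84,91), (23,46,71),
     (9,49,82), (36,27,12), (3,18,39), (14,8,85), (54,28,32), (42,45,44), (1,88,51), (6,20,70)],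
     (24,53), [(26,5), (41,98), (38,27), (27,99), (39,52), (43,47), (45,85), (46,54), (44,12),
     (13,81), (25,66), (17,70), (18,8), (39,5), (49,71), (34,66), (46,91)]),
   ([(59,57,2), (9,65,66), (85,6,86), (34,81,36), (88,37,79), (68,14,84), (46,80,17), (104,62,58),
     (25,18,29), (67,76,35), (1,83,75), (69,15,53), (56,77,43), (52,96,7), (8,5,95), (60,87,97),
     (33,91,44)], (94,4), [(31,19), (15,43), (41,100), (14,8), (21,52), (40,14), (36,72), (39,72),
     (40,78), (6,83), (23,87), (30,25), (22,10), (49,46), (48,26), (24,92), (19,94), (5,89)]),
   ([(41,89,6), (73,82,18), (14,86,103), (29,25,92), (81,70,36), (48,55,15), (2,96,44), (7,45,53),
     (100,94,87), (35,109,66), (37,42,85), (62,46,59), (52,33,93), (57,91,112), (97,102,75),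
     (9,90,8), (49,34,63), (83,110,5)], (74,12), [(52,50), (10,12), (32,9), (3,80), (47,10),
     (56,98), (54,83), (44,112), (21,49), (54,91), (47,73), (56,38), (25,85), (20,36), (4,24),
     (51,12), (26,95), (23,17), (14,102)]),
   ([(48,129,33), (46,117,44), (154,28,18), (104,77,119), (116,152,125), (95,134,138),
     (62,14,130), (37,12,15), (82,47,49), (142,55,90), (131,91,150), (63,105,52), (139,74,67),
     (80,132,72), (136,71,124), (151,144,59), (57,101,35), (145,97,22), (135,115,94), (29,41,102),
     (128,70,6), (2,123,8), (66,34,42), (43,86,7), (68,146,45)], (56,79), [(56,137), (13,50),
     (38,89), (30,125), (49,106), (16,101), (37,31), (4,75), (25,63), (17,110), (9,10), (58,127),
     (24,93), (67,3), (55,44), (14,61), (16,47), (5,72), (14,114), (50,76), (17,121), (18,13),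
     (77,21), (57,29), (20,46), (45,154)]),
   ([(41,109,74), (79,48,73), (36,141,14), (33,69,9), (5,18,6), (62,70,2), (61,72,81),
     (137,27,12), (56,117,29), (94,38,121), (45,8,46), (42,59,63), (25,65,47), (135,50,43),
     (15,85,101), (107,49,95), (93,55,13), (19,34,130), (86,104,84), (126,150,17), (97,131,145),
     (122,22,1), (108,71,78), (140,151,157), (129,154,103), (3,133,138)], (110,124), [(29,78),
     (52,3), (5,71), (53,116), (65,97), (10,54), (47,158), (33,106), (19,86), (74,8), (32,94),
     (39,43), (59,2), (63,54), (58,120), (64,145), (45,91), (57,13), (47,131), (72,82), (41,133),
     (43,119), (59,138), (72,19), (74,35), (71,48), (29,106)]),
   ([(84,128,165), (9,209,67), (143,134,46), (103,139,94), (19,135,48), (178,175,161),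
     (177,162,71), (198,117,182), (36,140,153), (193,21,41), (93,7,34), (5,85,65), (1,97,12),
     (185,59,108), (188,39,109), (77,129,151), (101,126,63), (2,43,173), (100,32,171), (202,90,56),
     (205,68,119), (11,105,88), (25,211,23), (78,18,168), (29,15,141), (111,157,24), (52,132,57),
     (55,49,195), (113,212,8), (14,60,66), (69,95,28), (184,116,92), (145,199,79), (35,45,142),
     (189,91,133)], (164,154), [(84,123), (72,187), (94,59), (30,213), (28,185), (35,189), (50,71),
     (34,101), (31,184), (25,161), (83,33), (33,109), (21,214), (8,4), (90,162), (23,145), (51,178),
     (13,1), (102,151), (102,210), (96,93), (18,176), (55,62), (47,158), (53,173), (45,199),
     (101,192), (8,64), (38,78), (24,43), (48,132), (47,40), (100,18), (12,179), (32,105), (74,55)]),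
   ([(199,55,200), (167,46,25), (62,201,65), (117,6,84), (122,81,76), (144,161,217), (68,208,29),
     (102,34,12), (205,41,113), (48,146,185), (132,87,7), (193,107,56), (206,88,202), (207,170,98),
     (141,212,182), (42,197,139), (38,204,100), (115,59,35), (83,160,45), (125,148,174),
     (95,163,181), (136,218,116), (211,2,189), (63,97,103), (135,37,8), (157,67,94), (71,79,33),
     (109,43,171), (151,90,195), (1,129,101), (111,69,147), (52,5,49), (191,44,198), (168,149,66),
     (210,190,203), (130,93,57)], (78,194), [(54,25), (17,69), (14,25), (75,85), (108,60), (45,205),
     (31,122), (50,101), (79,111), (70,122), (30,65), (4,19), (76,26), (23,63), (89,154), (70,13),
     (35,53), (69,219), (53,117), (2,209), (10,215), (27,48), (32,140), (33,166), (97,212),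
     (54,101), (1,127), (59,193), (59,64), (49,92), (60,206), (95,103), (107,96), (83,74), (31,163),
     (91,134), (24,133)]),
   ([(35,176,36), (167,174,124), (188,42,48), (87,162,9), (101,200,121), (166,156,29), (67,47,59),
     (224,163,41), (56,7,102), (62,72,84), (66,169,12), (151,223,33), (136,16,5), (50,195,206),
     (94,199,25), (15,154,173), (214,141,78), (145,187,210), (68,120,6), (90,38,85), (2,208,100),
     (128,207,178), (197,98,122), (79,52,144), (63,93,109), (201,204,97), (123,22,217), (92,95,77),
     (131,112,18), (114,216,119), (74,88,34), (117,57,203), (196,70,152), (158,55,182), (1,8,37),
     (181,111,213), (147,89,81)], (44,43), [(59,169), (47,194), (53,27), (76,161), (111,28), (4,61),
     (67,182), (83,21), (67,135), (93,214), (4,153), (106,2), (31,48), (25,167), (34,36), (73,48),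
     (51,37), (49,187), (38,110), (68,33), (95,138), (42,98), (39,186), (16,55), (77,26), (71,214),
     (63,28), (30,193), (9,218), (6,23), (84,172), (96,189), (109,64), (57,168), (108,77), (41,97),
     (90,112), (76,91)]),
   ([(196,183,134), (190,35,68), (207,157,54), (214,105,164), (225,48,139), (62,219,15),
     (121,215,138), (33,177,217), (36,151,77), (158,12,110), (58,210,209), (114,146,189),
     (108,131,52), (229,34,117), (73,201,49), (79,180,7), (61,120,25), (176,169,162), (106,90,66),
     (2,63,204), (182,135,93), (192,230,104), (149,147,216), (59,194,60), (193,232,141),
     (137,45,220), (212,42,78), (211,206,111), (74,85,31), (186,20,153), (178,205,65), (9,223,130),
     (100,109,72), (145,97,115), (144,152,163), (142,107,203), (228,222,83), (166,6,195)], (46,132),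
     [(64,4), (106,22), (113,6), (32,17), (97,131), (10,79), (65,196), (70,57), (78,44), (51,105),
     (46,117), (115,143), (110,178), (12,42), (104,125), (27,85), (68,5), (53,73), (51,168),
     (106,215), (84,188), (39,16), (66,176), (55,80), (77,151), (97,211), (15,3), (10,212), (90,26),
     (4,192), (108,122), (9,157), (25,162), (75,72), (103,101), (114,167), (70,8), (87,35),
     (26,213)]),
   ([(101,45,166), (198,53,200), (88,113,154), (55,157,5), (128,120,63), (34,77,29), (134,164,71),
     (19,189,179), (3,109,100), (18,229,156), (206,87,48), (143,36,14), (102,22,228), (17,211,192),
     (165,66,174), (69,131,147), (185,78,218), (6,178,59), (181,2,112), (163,121,30), (215,114,46),
     (52,98,1), (196,44,219), (115,188,169), (122,68,93), (25,123,140), (235,133,35), (175,49,216),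
     (207,132,223), (148,199,159), (15,7,158), (135,72,42), (110,84,231), (201,153,37), (94,62,67),
     (57,79,213), (226,208,212), (95,9,97), (103,56,150)], (90,12), [(3,238), (13,58), (89,238),
     (56,108), (76,6), (82,61), (20,182), (3,58), (90,117), (24,42), (74,13), (15,59), (79,153),
     (40,155), (44,125), (49,66), (116,154), (104,84), (26,36), (71,228), (23,35), (24,187),
     (111,171), (80,114), (7,150), (43,14), (31,167), (105,232), (59,203), (109,6), (32,127),
     (100,211), (55,172), (15,46), (34,71), (109,162), (12,202), (21,104), (100,62), (35,189)]),
   ([(214,61,6), (112,90,178), (45,229,86), (58,38,27), (136,128,12), (235,242,68), (63,34,53),
     (30,65,203), (102,17,137), (29,88,185), (87,156,44), (95,110,169), (25,14,240), (13,144,153),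
     (163,151,48), (71,7,107), (181,15,127), (176,100,206), (126,111,85), (219,2,55), (91,1,75),
     (129,84,224), (59,225,77), (93,113,115), (204,171,146), (62,196,125), (213,33,141),
     (165,105,149), (222,22,97), (199,98,191), (103,198,9), (28,37,121), (4,167,57), (172,72,210),
     (131,43,221), (36,79,11), (122,56,226), (139,194,195), (179,175,52), (81,205,18)], (8,162),
     [(17,87), (42,29), (50,27), (18,235), (34,39), (12,208), (26,77), (82,241), (101,147),
     (118,188), (85,87), (114,197), (84,52), (64,47), (111,203), (69,188), (24,104), (119,98),
     (113,136), (34,61), (7,103), (49,129), (62,38), (47,33), (54,102), (21,81), (117,73), (51,46),
     (117,77), (52,146), (122,86), (109,3), (68,108), (32,31), (14,183), (115,154), (110,113),
     (67,73), (99,195), (78,65), (83,239)]),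
   ([(95,102,18), (76,44,176), (185,151,107), (97,231,192), (190,111,2), (63,224,49), (34,236,55),
     (248,197,88), (155,10,37), (186,219,84), (77,120,90), (171,89,187), (48,16,225), (68,182,146),
     (139,122,41), (213,200,98), (40,93,78), (11,170,198), (62,212,86), (43,83,71), (215,130,14),
     (72,117,9), (147,118,132), (191,94,124), (145,56,245), (234,87,226), (22,5,230), (115,159,169),
     (201,110,46), (216,221,250), (125,7,238), (193,85,79), (113,52,114), (143,24,101), (23,218,12),
     (123,247,142), (220,181,135), (8,29,209), (148,45,223), (160,67,232), (57,178,47)], (99,74),
     [(82,75), (99,103), (66,86), (84,23), (112,101), (83,59), (41,81), (71,12), (73,197),
     (107,144), (55,246), (16,215), (57,179), (8,172), (35,198), (47,121), (18,37), (111,80),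
     (67,164), (110,175), (88,126), (99,203), (60,242), (120,146), (68,136), (94,145), (1,158),
     (2,226), (22,92), (47,95), (96,162), (56,4), (41,90), (6,117), (122,113), (69,23), (57,35),
     (65,193), (110,128), (83,80), (55,58), (33,31)]),
   ([(238,95,187), (29,33,231), (44,111,36), (58,161,237), (112,218,202), (106,68,74),
     (165,15,46), (93,149,177), (12,2,56), (66,49,61), (210,100,6), (219,98,254), (8,197,168),
     (37,115,97), (57,88,125), (71,123,35), (34,136,113), (14,206,43), (204,127,227), (65,234,59),
     (91,193,153), (246,76,87), (120,78,94), (5,175,109), (48,233,241), (236,85,107), (195,126,102),
     (18,217,25), (41,42,240), (188,124,176), (244,110,50), (22,225,114), (205,1,84), (184,45,31),
     (63,72,171), (9,182,180), (101,141,103), (152,138,253), (129,79,140), (203,7,90), (158,67,122),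
     (230,174,139)], (247,229), [(124,194), (20,109), (44,140), (7,244), (33,175), (100,126),
     (10,27), (74,123), (19,252), (48,229), (1,130), (72,207), (27,49), (81,178), (39,200), (86,9),
     (112,236), (112,183), (73,162), (81,30), (125,210), (19,34), (105,232), (62,15), (43,116),
     (46,113), (45,93), (69,99), (41,116), (119,162), (126,167), (122,80), (3,111), (37,224),
     (85,225), (120,191), (39,159), (118,143), (34,21), (57,103), (109,4), (125,45), (3,110)]),
   ([(260,88,127), (78,179,71), (93,240,176), (141,297,126), (365,284,131), (339,204,37),
     (379,369,9), (215,211,172), (393,110,255), (167,357,363), (218,170,151), (36,247,100),
     (305,67,377), (122,360,72), (146,203,21), (312,290,384), (1,130,138), (169,109,29),
     (85,43,134), (7,276,356), (59,156,113), (294,10,281), (120,256,373), (97,220,234), (51,66,189),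
     (327,259,270), (185,238,8), (334,165,348), (164,242,361), (147,79,142), (42,313,368),
     (227,15,24), (106,279,303), (49,389,94), (44,221,183), (201,65,150), (274,112,200),
     (288,12,137), (367,48,31), (73,104,33), (199,233,187), (108,124,77), (266,57,5), (267,163,262),
     (80,314,19), (337,335,102), (235,207,319), (224,382,173), (118,250,197), (349,205,309),
     (378,158,214), (3,123,304), (278,375,63), (241,41,62), (372,320,14), (159,166,84),
     (64,308,243), (345,325,143), (25,96,99), (355,74,144), (217,246,52), (95,115,213), (55,186,45),
     (342,306,103), (202,132,54)], (69,391), [(121,227), (109,77), (91,379), (58,59), (27,140),
     (30,346), (11,37), (108,235), (141,393), (33,326), (41,116), (32,181), (130,25), (153,360),
     (110,387), (90,111), (188,194), (82,382), (134,87), (38,130), (149,23), (54,169), (145,297),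
     (187,110), (163,190), (129,243), (173,262), (155,50), (146,273), (30,330), (109,185), (17,227),
     (158,96), (56,176), (128,373), (66,377), (18,164), (102,366), (36,24), (150,289), (66,220),
     (121,48), (176,132), (174,113), (170,204), (189,23), (191,200), (155,122), (103,199),
     (180,354), (42,392), (187,247), (128,172), (166,67), (178,332), (62,376), (178,86), (101,260),
     (88,1), (116,90), (103,309), (93,252), (163,278), (170,142), (58,202), (167,391)]),
   ([(321,225,197), (241,194,62), (145,224,93), (273,232,138), (166,79,124), (253,126,7),
     (98,220,228), (392,190,342), (269,36,102), (34,302,88), (187,370,141), (374,351,341),
     (21,385,369), (15,182,216), (12,171,78), (292,310,118), (103,395,212), (309,105,373),
     (270,378,64), (155,305,375), (234,312,381), (111,151,25), (307,332,333), (84,340,348),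
     (272,233,5), (163,349,101), (188,331,46), (143,63,139), (1,397,77), (222,388,239),
     (254,66,137), (198,10,352), (327,51,371), (44,285,48), (54,150,100), (120,122,38),
     (278,242,315), (140,382,107), (29,330,205), (244,45,336), (142,125,280), (18,90,56),
     (14,206,362), (58,130,229), (248,3,85), (164,266,314), (293,8,215), (57,265,236), (67,295,319),
     (384,2,199), (134,208,95), (97,318,144), (191,178,55), (114,152,158), (325,390,201),
     (43,104,41), (209,47,115), (170,227,110), (288,81,274), (73,361,379), (37,24,368),
     (154,217,284), (112,240,35), (183,180,282), (72,146,156), (149,268,42)], (326,175), [(162,257),
     (164,137), (91,324), (105,98), (30,144), (36,16), (121,141), (65,219), (103,201), (161,352),
     (112,223), (118,166), (15,361), (145,212), (170,158), (55,316), (160,205), (58,395), (106,75),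
     (89,273), (19,389), (97,224), (41,97), (135,330), (176,244), (111,322), (198,286), (89,100),
     (32,140), (129,260), (85,147), (51,152), (161,22), (61,226), (14,294), (1,359), (86,35),
     (169,380), (110,341), (24,342), (104,255), (75,253), (169,23), (69,380), (22,309), (120,318),
     (49,297), (54,134), (11,300), (172,265), (165,26), (163,219), (32,138), (58,180), (88,230),
     (148,372), (5,215), (9,52), (118,376), (120,15), (129,286), (123,132), (90,181), (184,187),
     (30,103), (158,185), (7,373)])]"

lemma starters_ok: "list_all starter_ok starters"
  by code_simp

section \<open>Development of starters modulo N\<close>

definition shift :: "int \<Rightarrow> int \<Rightarrow> int \<Rightarrow> int" where
  "shift N s p = (if p < 0 then p else (p + s) mod N)"

definition develop :: "int \<Rightarrow> int quad list \<Rightarrow> int quad list" where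
  "develop N Q = concat (map (\<lambda>s. map (map_quad (shift N s)) Q) [0..N - 1])"

text \<open>Passing to pairs commutes with shifting, so the pairs of the development are the shifts
  of the base pairs. The function \<open>g\<close> stands for \<open>sides\<close> or
  \<open>spokes\<close>.\<close>

lemma concat_map_develop:
  assumes "\<And>h q. g (map_quad h q) = map (map_prod h h) (g q)"
  shows "concat (map g (develop N Q)) =
    concat (map (\<lambda>s. map (map_prod (shift N s) (shift N s)) (concat (map g Q))) [0..N - 1])"
proof -
  have "concat (map g (concat (map (\<lambda>s. map (map_quad (shift N s)) Q) ss))) =
      concat (map (\<lambda>s. map (map_prod (shift N s) (shift N s)) (concat (map g Q))) ss)" for ss
    by (induction ss) (simp_all add: map_concat assms comp_def)
  then show ?thesis by (simp add: develop_def)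
qed

text \<open>A shift is determined by its effect on one residue, and it carries one pair of residues
  to another exactly when their differences agree. If one point is fixed, it has to coincide with
  its target, and the other point determines the shift. A target of two fixed points is excluded:
  all shifts would reach it, or none.\<close>

lemma card_shift_eq:
  assumes "N > 0" "x < N" "y < N" "\<not> (x < 0 \<and> y < 0)"
  shows "card {s \<in> {0..N - 1}. shift N s p = x \<and> shift N s q = y} =
    of_bool (diff_key N (p, q) = diff_key N (x, y))"
proof -
  have shift_iff: "shift N s r = z \<longleftrightarrow> s = (z - r) mod N"
    if "s \<in> {0..N - 1}" "0 \<le> r" "0 \<le> z" "z < N" for s r z
  proof -
    have "(r + s) mod N = z \<longleftrightarrow> (r + s) mod N = z mod N" using that by simp
    also have "\<dots> \<longleftrightarrow> s mod N = (z - r) mod N"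
      by (simp add: mod_eq_dvd_iff algebra_simps)
    finally show ?thesis using that by (simp add: shift_def)
  qed
  have mem: "z mod N \<in> {0..N - 1}" for z using \<open>N > 0\<close> by (simp add: pos_mod_bound)
  have neg: "shift N s r = z \<longleftrightarrow> r = z" if "r < 0 \<or> z < 0" for s r z
    using that pos_mod_sign[OF \<open>N > 0\<close>, of "r + s"] by (auto simp: shift_def simp del: pos_mod_sign)
  have one: "{s \<in> {0..N - 1}. shift N s r = z} = {(z - r) mod N}" if "0 \<le> r" "0 \<le> z" "z < N" for r z
    using mem[of "z - r"] shift_iff[OF _ that] by auto
  have key: "0 \<le> z mod N" "z mod N < N" for z using \<open>N > 0\<close> by simp_all
  show ?thesis
  proof (cases "p < 0 \<or> q < 0 \<or> x < 0 \<or> y < 0")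
    case True
    consider "p < 0" "q < 0" | "p < 0" "q \<ge> 0" | "p \<ge> 0" "q < 0" | "p \<ge> 0" "q \<ge> 0" "x < 0 \<or> y < 0"
      using True by linarith
    then show ?thesis
    proof cases
      case 1
      then show ?thesis
        using assms key[of "x - y"] by (auto simp: neg diff_key_def)
    next
      case 2
      show ?thesis
      proof (cases "p = x")
        case True
        then show ?thesis using 2 assms one[of q y] by (auto simp: neg diff_key_def)
      next
        case False
        then show ?thesis using 2 assms key[of "x - y"] by (auto simp: neg diff_key_def)
      qed
    next
      case 3
      show ?thesis
      proof (cases "q = y")
        case True
        then show ?thesis using 3 assms one[of p x] by (auto simp: neg diff_key_def)
      next
        case False
        then show ?thesis using 3 assms key[of "x - y"] by (auto simp: neg diff_key_def)
      qed
    next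
      case 4
      then show ?thesis using assms key[of "p - q"] by (auto simp: neg diff_key_def)
    qed
  next
    case False
    have "{s \<in> {0..N - 1}. shift N s p = x \<and> shift N s q = y} =
        {s \<in> {0..N - 1}. s = (x - p) mod N \<and> (x - p) mod N = (y - q) mod N}"
    proof (rule Collect_cong, rule conj_cong, rule refl)
      fix s assume s: "s \<in> {0..N - 1}"
      have "shift N s p = x \<longleftrightarrow> s = (x - p) mod N" "shift N s q = y \<longleftrightarrow> s = (y - q) mod N"
        using shift_iff[OF s] False assms by auto
      then show "(shift N s p = x \<and> shift N s q = y) = (s = (x - p) mod N \<and> (x - p) mod N = (y - q) mod N)"
        by auto
    qed
    also have "\<dots> = (if (p - q) mod N = (x - y) mod N then {(x - p) mod N} else {})"
    proof -
      \<comment> \<open>The shifts required by the two coordinates agree exactly when the two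
        differences do.\<close>
      have "(x - p) mod N = (y - q) mod N \<longleftrightarrow> (p - q) mod N = (x - y) mod N"
        unfolding mod_eq_dvd_iff by (metis (no_types, opaque_lifting) diff_diff_eq2 add_diff_eq diff_diff_eq add.commute dvd_minus_iff minus_diff_eq)
      then show ?thesis using mem by auto
    qed
    finally show ?thesis using False by (simp add: diff_key_def)
  qed
qed

text \<open>Each base pair with the right key contributes one shift, so counts in the full
  development reduce to counts among the base keys.\<close>

lemma count_orbit:
  assumes "N > 0" "x < N" "y < N" "\<not> (x < 0 \<and> y < 0)"
  shows "count_list (concat (map (\<lambda>s. map (map_prod (shift N s) (shift N s)) P) [0..N - 1])) (x, y) =
    count_list (map (diff_key N) P) (diff_key N (x, y))"
proof -
  have "count_list (concat (map (\<lambda>s. map (map_prod (shift N s) (shift N s)) P) [0..N - 1])) (x, y) =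
      (\<Sum>s\<in>{0..N - 1}. count_list (map (map_prod (shift N s) (shift N s)) P) (x, y))"
    by (simp add: count_list_concat comp_def sum_list_distinct_conv_sum_set)
  also have "\<dots> = count_list (map (diff_key N) P) (diff_key N (x, y))"
  proof (induction P)
    case (Cons e P)
    obtain p q where e: "e = (p, q)" by (cases e)
    have "(\<Sum>s\<in>{0..N - 1}. of_bool (map_prod (shift N s) (shift N s) e = (x, y))) =
        card {s \<in> {0..N - 1}. shift N s p = x \<and> shift N s q = y}"
      by (simp add: e Int_def)
    also note card_shift_eq[OF assms]
    finally show ?case
      using Cons by (simp only: list.map count_list_Cons sum.distrib e)
  qed simp
  finally show ?thesis .
qed

text \<open>By \<open>count_orbit\<close> the count of a pair depends only on its key, and
  \<open>quads_ok\<close> prescribes how often each key occurs. That shifted quadruples are proper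
  follows from the absence of the keys 0 and \<open>N\<close>.\<close>

lemma nested_develop:
  assumes ok: "quads_ok t Q" and t: "t \<ge> 1"
  shows "nested {-1..6 * t - 2} {-1 - t..6 * t - 2} (develop (6 * t - 1) Q)"
proof -
  define N where "N = 6 * t - 1"
  let ?X = "{-1..6 * t - 2}" and ?Y = "{-1 - t..6 * t - 2}" and ?key = "diff_key N"
  define P R where "P = concat (map sides Q)" and "R = concat (map spokes Q)"
  have range: "-1 \<le> a \<and> -1 \<le> b \<and> -1 \<le> c \<and> -1 - t \<le> f" if "(a, b, c, f) \<in> set Q" for a b c f
    using ok that by (auto simp: quads_ok_def list_all_iff)
  have keyP: "tree_sort (map ?key P) = concat (map (replicate 2) ([-1] @ [1..6 * t - 2] @ [6 * t]))"
    using ok by (simp add: quads_ok_def N_def P_def)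
  have keyR: "tree_sort (map ?key R) = concat (map (replicate 3) [-1 - t..-2]) @ [-1] @ [1..6 * t - 2]
      @ [6 * t] @ concat (map (replicate 3) [6 * t + 1..7 * t])"
    using ok by (simp add: quads_ok_def N_def R_def)
  \<comment> \<open>These \<open>v\<close> cover the keys of ordered pairs of distinct points of
    \<open>X\<close>, as \<open>key_X\<close> shows.\<close>
  have cP: "count_list (map ?key P) v = 2" and cR: "count_list (map ?key R) v = 1"
    if "v = -1 \<or> v = 6 * t \<or> 1 \<le> v \<and> v \<le> 6 * t - 2" for v
    unfolding count_list_tree_sort[symmetric, of "map ?key _"] keyP keyR
    using that t
    by (auto simp: count_list_upto count_list_replicate count_list_replicate_upto[of "\<lambda>_. 2", simplified] count_list_replicate_upto[of "\<lambda>_. 3", simplified])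
  have cR3: "count_list (map ?key R) v = 3" if "-1 - t \<le> v" "v \<le> -2" for v
    unfolding count_list_tree_sort[symmetric, of "map ?key _"] keyR
    using that t by (auto simp: count_list_upto count_list_replicate_upto[of "\<lambda>_. 3", simplified])
  have "v \<noteq> 0 \<and> v \<noteq> N" if "v \<in> set (map ?key P) \<union> set (map ?key R)" for v
  proof -
    have "v \<in> set (tree_sort (map ?key P)) \<union> set (tree_sort (map ?key R))"
      using that by (simp add: set_tree_sort)
    then show ?thesis
      unfolding keyP keyR using t by (auto simp: N_def)
  qed
  then have key_ne: "?key (p, q) \<noteq> 0 \<and> ?key (p, q) \<noteq> N" if "(p, q) \<in> set P \<union> set R" for p q
    using that by auto
  have N: "N > 0" using t by (simp add: N_def)
  have nonneg: "0 \<le> z mod N" for z using N by simp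
  have shift_ne: "shift N s p \<noteq> shift N s q" if "(p, q) \<in> set P \<union> set R" for p q s
    using key_ne[OF that] nonneg[of "p + s"] nonneg[of "q + s"]
    by (auto simp: shift_def diff_key_def mod_eq_dvd_iff split: if_splits simp del: pos_mod_sign)
  have mod_le: "-1 \<le> z mod N" "- 1 - t \<le> z mod N" "z mod N \<le> 6 * t - 2" for z
    using nonneg[of z] pos_mod_bound[OF N, of z] t unfolding N_def by linarith+
  have shift_X: "shift N s p \<in> ?X" if "-1 \<le> p" for s p
    using that t mod_le[of "p + s"] by (auto simp: shift_def)
  have shift_Y: "shift N s p \<in> ?Y" if "-1 - t \<le> p" for s p
    using that t mod_le[of "p + s"] by (auto simp: shift_def)
  have "proper_quad ?X ?Y (map_quad (shift N s) q)" if "q \<in> set Q" for q s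
  proof -
    obtain a b c f where q: "q = (a, b, c, f)" by (cases q)
    have "set (sides q) \<subseteq> set P" "set (spokes q) \<subseteq> set R"
      using that by (auto simp: P_def R_def)
    then show ?thesis
      using range[of a b c f] that shift_X shift_Y shift_ne by (auto simp: q)
  qed
  then have proper: "\<forall>q \<in> set (develop N Q). proper_quad ?X ?Y q"
    by (auto simp: develop_def)
  have side: "side_count (develop N Q) x y = count_list (map ?key P) (?key (x, y))"
    and spoke: "spoke_count (develop N Q) x y = count_list (map ?key R) (?key (x, y))"
    if "x < N" "y < N" "\<not> (x < 0 \<and> y < 0)" for x y
    using count_orbit[OF N that]
    by (simp_all add: concat_map_develop sides_map_quad spokes_map_quad P_def R_def)
  have key_X: "?key (x, y) = -1 \<or> ?key (x, y) = 6 * t \<or> 1 \<le> ?key (x, y) \<and> ?key (x, y) \<le> 6 * t - 2"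
    if "x \<in> ?X" "y \<in> ?X" "x \<noteq> y" for x y
  proof (cases "x < 0 \<or> y < 0")
    case False
    then have "x mod N \<noteq> y mod N"
      using that by (simp add: N_def)
    then have "(x - y) mod N \<noteq> 0"
      by (simp add: mod_eq_dvd_iff dvd_eq_mod_eq_0)
    with False show ?thesis
      using pos_mod_sign[OF N, of "x - y"] pos_mod_bound[OF N, of "x - y"] by (auto simp: diff_key_def N_def)
  qed (use that in \<open>auto simp: diff_key_def N_def\<close>)
  have "spoke_count (develop N Q) x y \<le> 3" if "x \<in> ?X" "y \<in> ?Y - ?X" for x y
  proof (cases "x < 0")
    case True
    \<comment> \<open>Here both points are fixed, a case outside \<open>count_orbit\<close>. Such a
      spoke would come from a base spoke joining two fixed points, hence with key
      \<open>N\<close>.\<close>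
    have "(x, y) \<notin> set (concat (map spokes (develop N Q)))"
    proof
      assume "(x, y) \<in> set (concat (map spokes (develop N Q)))"
      then obtain s p q where "(p, q) \<in> set R" "x = shift N s p" "y = shift N s q"
        by (auto simp: concat_map_develop spokes_map_quad R_def)
      moreover have "shift N s p < 0 \<longleftrightarrow> p < 0" for p s
        by (simp add: shift_def leD[OF nonneg])
      moreover have "y < 0" using that by auto
      ultimately have "p < 0" "q < 0" "(p, q) \<in> set R" using True by metis+
      then show False using key_ne[of p q] by (simp add: diff_key_def)
    qed
    then have "spoke_count (develop N Q) x y = 0" by (rule count_list_0_iff[THEN iffD2])
    then show ?thesis by linarith
  next
    case False
    then show ?thesis
      using that spoke[of x y] cR3[of y] by (auto simp: diff_key_def N_def)
  qed
  then show ?thesis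
    using proper side spoke key_X cP cR unfolding nested_def N_def[symmetric]
    by (auto simp: N_def)
qed

lemma starter_nestable:
  assumes "starter_ok (K, e, T)" "T \<noteq> []"
  shows "nestable (length T)"
proof (rule nestableI)
  show "nested {-1..6 * int (length T) - 2} {-1 - int (length T)..6 * int (length T) - 2}
      (develop (6 * int (length T) - 1) (starter_quads (K, e, T)))"
    using assms by (intro nested_develop) (auto simp: starter_ok_def Suc_le_eq)
qed auto

section \<open>Group divisible designs with four and five groups\<close>

text \<open>On points below 35 the code is injective and turns lexicographic order into the order of
  the integers; the expected sorted list is then a plain double enumeration.\<close>

definition pair_code :: "int \<times> int \<Rightarrow> int" where
  "pair_code = (\<lambda>(p, q). 35 * p + q)"

definition pairs_ok :: "int \<Rightarrow> (int \<Rightarrow> int \<Rightarrow> nat) \<Rightarrow> (int \<times> int) list \<Rightarrow> bool" where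
  "pairs_ok m M P \<longleftrightarrow> tree_sort (map pair_code P) =
     concat (map (\<lambda>p. concat (map (\<lambda>q. replicate (M p q) (pair_code (p, q))) [0..m - 1])) [0..m - 1])"

text \<open>The point \<open>7 i + l\<close> lies in group \<open>i\<close> on level \<open>l\<close>; level \<open>6\<close> holds the additional points.\<close>

definition side_mult :: "int \<Rightarrow> int \<Rightarrow> nat" where
  "side_mult p q = (if p div 7 = q div 7 \<or> p mod 7 = 6 \<or> q mod 7 = 6 then 0 else 2)"

definition spoke_mult :: "int \<Rightarrow> int \<Rightarrow> nat" where
  "spoke_mult p q = (if p div 7 = q div 7 \<or> p mod 7 = 6 \<and> q mod 7 = 6 then 0
     else if p mod 7 = 6 \<or> q mod 7 = 6 then 3 else 1)"

definition gdd_ok :: "int \<Rightarrow> int quad list \<Rightarrow> bool" where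
  "gdd_ok m L \<longleftrightarrow>
     list_all (\<lambda>(a, b, c, f). 0 \<le> a \<and> a < m \<and> 0 \<le> b \<and> b < m \<and> 0 \<le> c \<and> c < m \<and> 0 \<le> f \<and> f < m) L \<and>
     pairs_ok m side_mult (concat (map sides L)) \<and>
     pairs_ok m spoke_mult (concat (map spokes L))"

text \<open>A permutation of order three inside each group, with cycles (0 1 2) and (3 4 5) on the
  levels; level 6 is fixed.\<close>

definition turn :: "int \<Rightarrow> int" where
  "turn p = p + [1, 1, -2, 1, 1, -2, 0] ! nat (p mod 7)"

text \<open>The designs are invariant under the permutation \<open>turn\<close> of the levels, the second one also under
  rotation of the five groups. The base blocks were found with a SAT solver.\<close>

definition gdd4 :: "int quad list" where
  "gdd4 = concat (map (\<lambda>h. map (map_quad h) [(0,7,15,27), (0,9,18,22), (0,9,18,27), (0,10,17,27), (0,12,16,24), (0,12,16,26),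
   (3,7,17,27), (3,8,19,24), (3,9,16,23), (3,10,16,27), (3,11,14,27), (3,12,19,22),
   (0,7,23,20), (0,8,21,15), (0,8,25,20), (0,10,22,20), (0,11,21,16), (0,11,26,19),
   (3,7,21,20), (3,8,23,18), (3,9,26,14), (3,10,24,20), (3,11,26,17), (3,12,25,20),
   (0,14,23,8), (0,14,26,10), (0,15,22,13), (0,17,24,13), (0,19,24,13), (0,19,25,7),
   (3,14,22,13), (3,15,23,12), (3,15,25,13), (3,17,22,10), (3,18,21,13), (3,18,24,7),
   (7,14,25,6), (7,15,26,1), (7,16,22,4), (7,16,26,6), (7,17,21,6), (7,18,25,5),
   (10,15,22,6), (10,15,24,5), (10,18,21,6), (10,18,26,6), (10,19,21,1), (10,19,23,2)]) [id, turn, turn \<circ> turn])"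

definition gdd5 :: "int quad list" where
  "gdd5 = concat (map (\<lambda>h. concat (map (\<lambda>s. map (map_quad (\<lambda>p. h ((p + s) mod 35)))
     [(0,7,14,34), (0,8,14,34), (0,9,18,29), (0,11,15,27), (0,11,17,21), (0,8,32,19),
   (3,11,19,27), (0,25,31,16), (0,10,25,17), (0,10,26,20), (0,12,24,33), (0,16,33,10),
   (0,15,33,7), (0,16,32,13), (0,19,26,13), (3,10,24,34)]) [0, 7, 14, 21, 28])) [id, turn, turn \<circ> turn])"

lemma gdd4_ok: "gdd_ok 28 gdd4"
  by code_simp

lemma gdd5_ok: "gdd_ok 35 gdd5"
  by code_simp
text \<open>Here \<open>S\<close> indexes the groups. Pairs within one group, its additional point
  included, stay uncovered and are left to the designs on larger sets of groups.\<close>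

definition gdd :: "'i set \<Rightarrow> ('i \<times> nat) quad list \<Rightarrow> bool" where
  "gdd S L \<longleftrightarrow> (\<forall>q \<in> set L. proper_quad (S \<times> {..<6}) (S \<times> {..<7}) q) \<and>
     (\<forall>i\<in>S. \<forall>j\<in>S. \<forall>k<7. \<forall>l<7.
        side_count L (i, k) (j, l) = (if i = j \<or> k = 6 \<or> l = 6 then 0 else 2) \<and>
        spoke_count L (i, k) (j, l) =
          (if i = j \<or> k = 6 \<and> l = 6 then 0 else if k = 6 \<or> l = 6 then 3 else 1))"

lemma pairs_okD:
  assumes "pairs_ok m M P" "set P \<subseteq> {0..<m} \<times> {0..<m}" "m \<le> 35" "p \<in> {0..<m}" "q \<in> {0..<m}"
  shows "count_list P (p, q) = M p q"
proof -
  have code_eq: "pair_code (p', q') = pair_code (p, q) \<longleftrightarrow> p' = p \<and> q' = q"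
    if "p' \<in> {0..<m}" "q' \<in> {0..<m}" for p' q'
  proof -
    have "(35 * a + b) div 35 = a" if "b \<in> {0..<m}" for a b :: int
      using that assms(3) by simp
    then have "p' = p" if "35 * p' + q' = 35 * p + q"
      using that \<open>q' \<in> {0..<m}\<close> assms(5) by metis
    then show ?thesis by (auto simp: pair_code_def)
  qed
  have "count_list P (p, q) = count_list (map pair_code P) (pair_code (p, q))"
    using assms(2) by (induction P) (auto simp: code_eq)
  also have "\<dots> = count_list (tree_sort (map pair_code P)) (pair_code (p, q))"
    by (simp add: count_list_tree_sort)
  also have "\<dots> = (\<Sum>p'\<in>{0..m - 1}. \<Sum>q'\<in>{0..m - 1}.
      if pair_code (p', q') = pair_code (p, q) then M p' q' else 0)"
    using assms(1)
    by (simp add: pairs_ok_def count_list_concat comp_def count_list_replicate sum_list_distinct_conv_sum_set)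
  also have "\<dots> = (\<Sum>p'\<in>{0..m - 1}. \<Sum>q'\<in>{0..m - 1}. if p' = p \<and> q' = q then M p' q' else 0)"
    by (intro sum.cong refl) (simp add: code_eq)
  also have "\<dots> = (\<Sum>p'\<in>{0..m - 1}. if p' = p then M p' q else 0)"
    using assms(5) by (intro sum.cong refl) (auto simp: sum.delta)
  also have "\<dots> = M p q"
    using assms(4) by (simp add: sum.delta)
  finally show ?thesis .
qed

text \<open>The integer model is carried to the groups in \<open>S\<close> by splitting a point into
  quotient and remainder modulo 7 and numbering \<open>S\<close> by the quotients.\<close>

lemma gdd_okD:
  assumes ok: "gdd_ok (7 * int n) L" and n: "n \<le> 5" and S: "finite S" "card S = n"
  shows "\<exists>L'. gdd S L'"
proof -
  obtain g where g: "bij_betw g {..<n} S"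
    using S finite_same_card_bij[of "{..<n}" S] by auto
  define h where "h p = (g (nat (p div 7)), nat (p mod 7))" for p :: int
  let ?I = "{0..<7 * int n}"
  have div: "nat (p div 7) < n" if "p \<in> ?I" for p using that by auto
  have g_eq: "g (nat (p div 7)) = g (nat (q div 7)) \<longleftrightarrow> p div 7 = q div 7" if "p \<in> ?I" "q \<in> ?I" for p q
    using that g div[of p] div[of q] by (auto simp: bij_betw_def inj_on_eq_iff eq_nat_nat_iff pos_imp_zdiv_nonneg_iff)
  have inj: "inj_on h ?I"
  proof
    fix p q assume "p \<in> ?I" "q \<in> ?I" "h p = h q"
    then have "p div 7 = q div 7" "p mod 7 = q mod 7"
      using g_eq by (auto simp: h_def nat_eq_iff)
    then show "p = q" by (metis div_mult_mod_eq)
  qed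
  have range: "set L \<subseteq> ?I \<times> ?I \<times> ?I \<times> ?I"
    using ok by (auto simp: gdd_ok_def list_all_iff)
  have sub: "set (concat (map sides L)) \<subseteq> ?I \<times> ?I" "set (concat (map spokes L)) \<subseteq> ?I \<times> ?I"
    using range by fastforce+
  have side: "side_count L p q = side_mult p q" and spoke: "spoke_count L p q = spoke_mult p q"
    if "p \<in> ?I" "q \<in> ?I" for p q
    using pairs_okD[OF _ _ _ that] ok sub n by (auto simp: gdd_ok_def)
  have h_S: "h p \<in> S \<times> {..<7}" and h_S6: "p mod 7 \<noteq> 6 \<Longrightarrow> h p \<in> S \<times> {..<6}" if "p \<in> ?I" for p
    using div[OF that] g pos_mod_bound[of 7 p] by (auto simp: h_def bij_betw_def nat_less_iff)
  \<comment> \<open>A listed pair has positive multiplicity, so its ends lie in different groups,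
    and for a side neither end has level 6. This yields properness, while \<open>gdd_ok\<close>
    itself checks only ranges and counts.\<close>
  have side_ne: "side_mult p q \<noteq> 0" if "(p, q) \<in> set (sides e)" "e \<in> set L" for p q e
    using that side[of p q] sub(1) by (force simp: count_list_0_iff)
  have spoke_ne: "spoke_mult p q \<noteq> 0" if "(p, q) \<in> set (spokes e)" "e \<in> set L" for p q e
    using that spoke[of p q] sub(2) by (force simp: count_list_0_iff)
  have proper: "proper_quad (S \<times> {..<6}) (S \<times> {..<7}) (map_quad h e)" if e: "e \<in> set L" for e
  proof -
    obtain a b c f where abcf: "e = (a, b, c, f)" by (cases e)
    have I: "a \<in> ?I" "b \<in> ?I" "c \<in> ?I" "f \<in> ?I" using range e abcf by auto
    have "side_mult a b \<noteq> 0" "side_mult a c \<noteq> 0" "side_mult b c \<noteq> 0"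
      using side_ne[OF _ e] by (auto simp: abcf)
    then have "a \<noteq> b" "a \<noteq> c" "b \<noteq> c" and six: "a mod 7 \<noteq> 6" "b mod 7 \<noteq> 6" "c mod 7 \<noteq> 6"
      unfolding side_mult_def by metis+
    moreover have "spoke_mult a f \<noteq> 0" "spoke_mult b f \<noteq> 0" "spoke_mult c f \<noteq> 0"
      using spoke_ne[OF _ e] by (auto simp: abcf)
    then have "a \<noteq> f" "b \<noteq> f" "c \<noteq> f"
      unfolding spoke_mult_def by metis+
    ultimately have "distinct [h a, h b, h c, h f]"
      using I by (simp add: inj_on_eq_iff[OF inj])
    then show ?thesis
      using h_S6[OF I(1) six(1)] h_S6[OF I(2) six(2)] h_S6[OF I(3) six(3)] h_S[OF I(4)]
      unfolding abcf map_quad.simps proper_quad.simps by blast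
  qed
  have side': "side_count (map (map_quad h) L) (i, k) (j, l) = (if i = j \<or> k = 6 \<or> l = 6 then 0 else 2)"
    and spoke': "spoke_count (map (map_quad h) L) (i, k) (j, l) =
      (if i = j \<or> k = 6 \<and> l = 6 then 0 else if k = 6 \<or> l = 6 then 3 else 1)"
    if ij: "i \<in> S" "j \<in> S" "k < 7" "l < 7" for i j k l
  proof -
    obtain i' j' where i': "i = g i'" "i' < n" and j': "j = g j'" "j' < n"
      using ij g by (auto simp: bij_betw_def)
    define p q where "p = 7 * int i' + int k" and "q = 7 * int j' + int l"
    have p: "p \<in> ?I" "p div 7 = int i'" "p mod 7 = int k" and q: "q \<in> ?I" "q div 7 = int j'" "q mod 7 = int l"
      using ij i' j' by (auto simp: p_def q_def)
    then have hpq: "h p = (i, k)" "h q = (j, l)"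
      by (auto simp: h_def i' j')
    have "i = j \<longleftrightarrow> i' = j'"
      using g i' j' by (auto simp: bij_betw_def inj_on_eq_iff)
    then show "side_count (map (map_quad h) L) (i, k) (j, l) = (if i = j \<or> k = 6 \<or> l = 6 then 0 else 2)"
      and "spoke_count (map (map_quad h) L) (i, k) (j, l) =
        (if i = j \<or> k = 6 \<and> l = 6 then 0 else if k = 6 \<or> l = 6 then 3 else 1)"
      unfolding hpq[symmetric] concat_sides_map_quad concat_spokes_map_quad
        count_list_map_prod[OF inj sub(1) p(1) q(1)] count_list_map_prod[OF inj sub(2) p(1) q(1)]
        side[OF p(1) q(1)] spoke[OF p(1) q(1)]
      using p q by (auto simp: side_mult_def spoke_mult_def hpq)
  qed
  have "gdd S (map (map_quad h) L)"
    unfolding gdd_def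
  proof (intro conjI ballI allI impI)
    fix q assume "q \<in> set (map (map_quad h) L)"
    then show "proper_quad (S \<times> {..<6}) (S \<times> {..<7}) q" using proper by auto
  qed (rule side' spoke'; assumption)+
  then show ?thesis ..
qed
section \<open>Truncated transversal designs\<close>

lemma proper_quad_mono: "proper_quad X Y q \<Longrightarrow> X \<subseteq> X' \<Longrightarrow> Y \<subseteq> Y' \<Longrightarrow> proper_quad X' Y' q"
  by (cases q) auto

lemma side_count_outside:
  assumes "\<forall>q \<in> set L. proper_quad X Y q" "x \<notin> X \<or> y \<notin> X"
  shows "side_count L x y = 0"
  using assms set_sides[of X Y] by (fastforce simp: count_list_0_iff)

lemma spoke_count_outside:
  assumes "\<forall>q \<in> set L. proper_quad X Y q" "X \<subseteq> Y" "x \<notin> Y \<or> y \<notin> Y"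
  shows "spoke_count L x y = 0"
  using assms set_spokes[of X Y] by (fastforce simp: count_list_0_iff)

lemma sum_single:
  fixes f :: "'a \<Rightarrow> nat"
  assumes "finite A" "a \<in> A" "\<And>b. b \<in> A \<Longrightarrow> b \<noteq> a \<Longrightarrow> f b = 0"
  shows "sum f A = f a"
  using assms by (subst sum.remove[of A a]) auto

text \<open>Wilson's fundamental construction: each point of \<open>S\<close> is replaced by six
  points and an additional one. Pairs over a common member of \<open>Gs\<close> are covered by the
  design on that member alone, all others by the ingredient on the one block through both.\<close>

lemma nestable_pbd:
  fixes S :: "'i set" and Bs Gs :: "'i set set"
  assumes S: "finite S" and fin: "finite Bs" "finite Gs"
    and gdd: "\<And>b. b \<in> Bs \<Longrightarrow> b \<subseteq> S \<and> (\<exists>L. gdd b L)"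
    and nestable: "\<And>g. g \<in> Gs \<Longrightarrow> g \<subseteq> S \<and> nestable (card g)"
    and group: "\<And>i. i \<in> S \<Longrightarrow> \<exists>!g. g \<in> Gs \<and> i \<in> g"
    and inner: "\<And>i j b g. i \<noteq> j \<Longrightarrow> g \<in> Gs \<Longrightarrow> i \<in> g \<Longrightarrow> j \<in> g \<Longrightarrow> b \<in> Bs \<Longrightarrow> \<not> (i \<in> b \<and> j \<in> b)"
    and outer: "\<And>i j. i \<in> S \<Longrightarrow> j \<in> S \<Longrightarrow> \<not> (\<exists>g \<in> Gs. i \<in> g \<and> j \<in> g) \<Longrightarrow> \<exists>!b. b \<in> Bs \<and> i \<in> b \<and> j \<in> b"
  shows "nestable (card S)"
proof -
  obtain F where F: "\<And>b. b \<in> Bs \<Longrightarrow> gdd b (F b)"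
    using gdd by metis
  have "\<exists>L. nested (g \<times> {..<6::nat}) (g \<times> {..<7}) L" if "g \<in> Gs" for g
    using that nestable[OF that] S by (intro nestableD[of "card g"]) (auto simp: card_cartesian_product intro: finite_subset)
  then obtain G where G: "\<And>g. g \<in> Gs \<Longrightarrow> nested (g \<times> {..<6::nat}) (g \<times> {..<7}) (G g)"
    by metis
  obtain bs where bs: "set bs = Bs" "distinct bs" using fin finite_distinct_list by metis
  obtain gs where gs: "set gs = Gs" "distinct gs" using fin finite_distinct_list by metis
  define L where "L = concat (map F bs) @ concat (map G gs)"
  let ?X = "S \<times> {..<6::nat}" and ?Y = "S \<times> {..<7::nat}"
  have proper_F: "\<forall>q \<in> set (F b). proper_quad (b \<times> {..<6}) (b \<times> {..<7}) q" if "b \<in> Bs" for b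
    using F[OF that] by (simp add: gdd_def)
  have proper_G: "\<forall>q \<in> set (G g). proper_quad (g \<times> {..<6}) (g \<times> {..<7}) q" if "g \<in> Gs" for g
    using G[OF that] by (simp add: nested_def)
  have count_L: "count_list (concat (map f L)) e =
      (\<Sum>b\<in>Bs. count_list (concat (map f (F b))) e) + (\<Sum>g\<in>Gs. count_list (concat (map f (G g))) e)"
    for f :: "('i \<times> nat) quad \<Rightarrow> (('i \<times> nat) \<times> ('i \<times> nat)) list" and e
  proof -
    have "count_list (concat (map f (concat xss))) e = (\<Sum>xs\<leftarrow>xss. count_list (concat (map f xs)) e)" for xss
      by (induction xss) auto
    then show ?thesis
      by (simp add: L_def comp_def sum_list_distinct_conv_sum_set bs gs)
  qed
  have F_side0: "side_count (F b) (i, k) (j, l) = 0" if "b \<in> Bs" "\<not> (i \<in> b \<and> j \<in> b)" for b i j k l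
    using that by (intro side_count_outside[OF proper_F]) auto
  have F_spoke0: "spoke_count (F b) (i, k) (j, l) = 0" if "b \<in> Bs" "\<not> (i \<in> b \<and> j \<in> b)" for b i j k l
    using that by (intro spoke_count_outside[OF proper_F]) auto
  have G_side0: "side_count (G g) (i, k) (j, l) = 0" if "g \<in> Gs" "\<not> (i \<in> g \<and> j \<in> g)" for g i j k l
    using that by (intro side_count_outside[OF proper_G]) auto
  have G_spoke0: "spoke_count (G g) (i, k) (j, l) = 0" if "g \<in> Gs" "\<not> (i \<in> g \<and> j \<in> g)" for g i j k l
    using that by (intro spoke_count_outside[OF proper_G]) auto
  have same: "\<exists>g \<in> Gs. i \<in> g \<and> j \<in> g \<and> side_count L (i, k) (j, l) = side_count (G g) (i, k) (j, l) \<and>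
      spoke_count L (i, k) (j, l) = spoke_count (G g) (i, k) (j, l)"
    if g: "g \<in> Gs" "i \<in> g" "j \<in> g" and "k < 7" "l < 7" for g i j k l
  proof -
    have F0: "side_count (F b) (i, k) (j, l) = 0 \<and> spoke_count (F b) (i, k) (j, l) = 0" if b: "b \<in> Bs" for b
    proof (cases "i \<in> b \<and> j \<in> b")
      case True
      \<comment> \<open>A block meets a group in at most one element, and over a single element an
        ingredient covers nothing.\<close>
      then have "i = j" using inner[of i j g b] g b by blast
      then show ?thesis using F[OF b] True \<open>k < 7\<close> \<open>l < 7\<close> by (simp add: gdd_def)
    qed (use F_side0 F_spoke0 b in blast)
    have uniq: "i \<notin> g'" if "g' \<in> Gs" "g' \<noteq> g" for g'
      using group[of i] nestable[OF g(1)] g that by blast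
    have "(\<Sum>g\<in>Gs. side_count (G g) (i, k) (j, l)) = side_count (G g) (i, k) (j, l)"
      by (rule sum_single[OF fin(2) g(1)]) (use uniq G_side0 in blast)
    moreover have "(\<Sum>g\<in>Gs. spoke_count (G g) (i, k) (j, l)) = spoke_count (G g) (i, k) (j, l)"
      by (rule sum_single[OF fin(2) g(1)]) (use uniq G_spoke0 in blast)
    ultimately show ?thesis
      using g F0 by (intro bexI[of _ g]) (simp_all add: count_L)
  qed
  have diff: "\<exists>b \<in> Bs. i \<in> b \<and> j \<in> b \<and> side_count L (i, k) (j, l) = side_count (F b) (i, k) (j, l) \<and>
      spoke_count L (i, k) (j, l) = spoke_count (F b) (i, k) (j, l)"
    if ij: "i \<in> S" "j \<in> S" and g: "\<not> (\<exists>g \<in> Gs. i \<in> g \<and> j \<in> g)" for i j k l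
  proof -
    obtain b where b: "b \<in> Bs" "i \<in> b" "j \<in> b" and uniq: "\<And>b'. b' \<in> Bs \<Longrightarrow> b' \<noteq> b \<Longrightarrow> \<not> (i \<in> b' \<and> j \<in> b')"
      using outer[OF ij g] by blast
    have "(\<Sum>b\<in>Bs. side_count (F b) (i, k) (j, l)) = side_count (F b) (i, k) (j, l)"
      by (rule sum_single[OF fin(1) b(1)]) (use uniq F_side0 in blast)
    moreover have "(\<Sum>b\<in>Bs. spoke_count (F b) (i, k) (j, l)) = spoke_count (F b) (i, k) (j, l)"
      by (rule sum_single[OF fin(1) b(1)]) (use uniq F_spoke0 in blast)
    moreover have "(\<Sum>g\<in>Gs. side_count (G g) (i, k) (j, l)) = 0"
      by (intro sum.neutral ballI G_side0) (use g in auto)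
    moreover have "(\<Sum>g\<in>Gs. spoke_count (G g) (i, k) (j, l)) = 0"
      by (intro sum.neutral ballI G_spoke0) (use g in auto)
    ultimately show ?thesis
      using b by (intro bexI[of _ b]) (simp_all add: count_L)
  qed
  have "proper_quad ?X ?Y q" if q: "q \<in> set L" for q
  proof -
    consider b where "b \<in> Bs" "q \<in> set (F b)" | g where "g \<in> Gs" "q \<in> set (G g)"
      using q by (auto simp: L_def bs gs)
    then obtain s where "s \<subseteq> S" "proper_quad (s \<times> {..<6}) (s \<times> {..<7}) q"
      by cases (use gdd nestable proper_F proper_G in metis)+
    then show ?thesis by (auto intro: proper_quad_mono)
  qed
  moreover have "side_count L x y = 2 \<and> spoke_count L x y \<le> 1" if xy: "x \<in> ?X" "y \<in> ?X" "x \<noteq> y" for x y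
  proof -
    obtain i k j l where ij: "x = (i, k)" "y = (j, l)" "i \<in> S" "j \<in> S" "k < 6" "l < 6"
      using xy by auto
    show ?thesis
    proof (cases "\<exists>g \<in> Gs. i \<in> g \<and> j \<in> g")
      case True
      then obtain g where "g \<in> Gs" "i \<in> g" "j \<in> g"
        "side_count L x y = side_count (G g) x y" "spoke_count L x y = spoke_count (G g) x y"
        using same[of _ i j k l] ij by auto
      then show ?thesis using G[of g] xy ij by (simp add: nested_def)
    next
      case False
      then have "i \<noteq> j" using group[of i] ij by blast
      moreover obtain b where "b \<in> Bs" "i \<in> b" "j \<in> b"
        "side_count L x y = side_count (F b) x y" "spoke_count L x y = spoke_count (F b) x y"
        using diff[OF _ _ False, of k l] ij by auto
      ultimately show ?thesis using F[of b] ij by (simp add: gdd_def)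
    qed
  qed
  moreover have "spoke_count L x y \<le> 3" if xy: "x \<in> ?X" "y \<in> ?Y - ?X" for x y
  proof -
    obtain i k j where ij: "x = (i, k)" "y = (j, 6)" "i \<in> S" "j \<in> S" "k < 6"
      using xy by force
    show ?thesis
    proof (cases "\<exists>g \<in> Gs. i \<in> g \<and> j \<in> g")
      case True
      then obtain g where "g \<in> Gs" "i \<in> g" "j \<in> g" "spoke_count L x y = spoke_count (G g) x y"
        using same[of _ i j k 6] ij by auto
      then show ?thesis using G[of g] ij by (simp add: nested_def)
    next
      case False
      then obtain b where "b \<in> Bs" "i \<in> b" "j \<in> b" "spoke_count L x y = spoke_count (F b) x y"
        using diff[OF _ _ False, of k 6] ij by auto
      then show ?thesis using F[of b] ij by (simp add: gdd_def)
    qed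
  qed
  ultimately have "nested ?X ?Y L"
    by (simp add: nested_def)
  then show ?thesis
    by (rule nestableI) (use S in \<open>auto simp: card_cartesian_product\<close>)
qed

lemma gdd_exists:
  assumes "finite S" "card S = 4 \<or> card S = 5"
  shows "\<exists>L. gdd S L"
  using assms gdd_okD[of 4 gdd4 S] gdd_okD[of 5 gdd5 S] gdd4_ok gdd5_ok by auto

text \<open>Subtracting the two congruences gives \<open>(d - c) * b\<close> congruent to
  \<open>(d - c) * b'\<close>. The factor is one of 1, 2, 3, 4, hence a unit modulo
  \<open>m\<close>.\<close>

lemma lines_inj:
  fixes m :: nat
  assumes m: "coprime m 6" and c: "c < 5" "d < 5" "c < d"
    and eq: "(a + c * b) mod m = (a' + c * b') mod m" "(a + d * b) mod m = (a' + d * b') mod m"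
    and less: "a < m" "b < m" "a' < m" "b' < m"
  shows "a = a' \<and> b = b'"
proof -
  have "coprime (d - c) m"
  proof -
    have "d - c \<in> {1, 2, 3, 4}" using c by auto
    moreover have "coprime 2 m" "coprime 3 m"
      using m coprime_mult_right_iff[of m 2 3] by (auto simp: coprime_commute)
    moreover have "coprime 4 m"
      using \<open>coprime 2 m\<close> coprime_mult_left_iff[of 2 2 m] by simp
    ultimately show ?thesis by auto
  qed
  have "[int (d - c) * int b = int (d - c) * int b'] (mod int m)"
  proof -
    have "[int a + int c * int b = int a' + int c * int b'] (mod int m)"
      "[int a + int d * int b = int a' + int d * int b'] (mod int m)"
      using eq by (simp_all add: cong_int_iff[symmetric] cong_def flip: of_nat_mult of_nat_add zmod_int)
    from cong_diff[OF this(2,1)] show ?thesis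
      using c by (simp add: of_nat_diff algebra_simps)
  qed
  then have "[int b = int b'] (mod int m)"
    using \<open>coprime (d - c) m\<close> by (simp add: cong_mult_lcancel)
  then have b: "b = b'"
    using less by (simp add: cong_int_iff cong_less_modulus_unique_nat)
  then have "[a + c * b = a' + c * b] (mod m)"
    using eq by (simp add: cong_def)
  then have "[a = a'] (mod m)"
    by (simp add: cong_add_rcancel_nat)
  then show ?thesis
    using less b by (simp add: cong_less_modulus_unique_nat)
qed

text \<open>By \<open>lines_inj\<close>, evaluation at \<open>c\<close> and \<open>d\<close> is an
  injective map of a finite set into itself, hence surjective.\<close>

lemma lines_surj:
  fixes m :: nat
  assumes m: "coprime m 6" and c: "c < 5" "d < 5" "c \<noteq> d" and xy: "x < m" "y < m"
  shows "\<exists>a<m. \<exists>b<m. (a + c * b) mod m = x \<and> (a + d * b) mod m = y"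
proof -
  let ?f = "\<lambda>(a, b). ((a + c * b) mod m, (a + d * b) mod m)"
  let ?A = "{..<m} \<times> {..<m}"
  have "inj_on ?f ?A"
  proof (rule inj_onI)
    fix p p' assume p: "p \<in> ?A" "p' \<in> ?A" "?f p = ?f p'"
    obtain a b a' b' where ab: "p = (a, b)" "p' = (a', b')" by fastforce
    show "p = p'"
    proof (cases "c < d")
      case True
      then show ?thesis using lines_inj[OF m c(1,2), of a b a' b'] p by (simp add: ab)
    next
      case False
      then show ?thesis using lines_inj[OF m c(2,1), of a b a' b'] c(3) p by (simp add: ab)
    qed
  qed
  moreover have "?f ` ?A \<subseteq> ?A"
    using xy by auto
  ultimately have "?f ` ?A = ?A"
    by (intro endo_inj_surj) auto
  then have "(x, y) \<in> ?f ` ?A"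
    using xy by simp
  then show ?thesis by (force simp: image_iff)
qed

text \<open>Two points of different groups lie on exactly one line, and deleting other points does
  not change this. Only the last group is cut, so a line loses at most one of its five
  points.\<close>

lemma nestable_truncated_td:
  assumes m: "coprime m 6" and u: "u \<le> m" and nest: "nestable m" "nestable u"
  shows "nestable (4 * m + u)"
proof -
  define n :: "nat \<Rightarrow> nat" where "n c = (if c < 4 then m else u)" for c
  define S where "S = (SIGMA c:{..<5}. {..<n c})"
  define line where "line a b = (\<lambda>c. (c, (a + c * b) mod m)) ` {..<5::nat} \<inter> S" for a b
  let ?Bs = "(\<lambda>(a, b). line a b) ` ({..<m} \<times> {..<m})" and ?Gs = "(\<lambda>c. {c} \<times> {..<n c}) ` {..<5}"
  have n_le: "n c \<le> m" for c using u by (simp add: n_def)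
  have "nestable (card S)"
  proof (rule nestable_pbd)
    show "finite S" by (simp add: S_def)
    fix b assume "b \<in> ?Bs"
    then obtain a d where "a < m" and b: "b = line a d" by auto
    let ?f = "\<lambda>c. (c, (a + c * d) mod m)"
    have inj: "inj_on ?f A" for A by (auto simp: inj_on_def)
    have "?f ` {..<4} \<subseteq> b"
      using \<open>a < m\<close> by (auto simp: b line_def S_def n_def)
    moreover have fin: "finite b" "b \<subseteq> ?f ` {..<5}" by (auto simp: b line_def)
    ultimately have "4 \<le> card b" "card b \<le> 5"
      using card_mono[of b "?f ` {..<4}"] card_mono[of "?f ` {..<5}" b] by (simp_all add: card_image[OF inj])
    then show "b \<subseteq> S \<and> (\<exists>L. gdd b L)"
      using gdd_exists[OF fin(1)] by (force simp: b line_def)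
  next
    fix g assume "g \<in> ?Gs"
    then show "g \<subseteq> S \<and> nestable (card g)"
      using nest by (auto simp: S_def n_def card_cartesian_product)
  next
    fix i assume "i \<in> S"
    then show "\<exists>!g. g \<in> ?Gs \<and> i \<in> g"
      by (intro ex1I[of _ "{fst i} \<times> {..<n (fst i)}"]) (auto simp: S_def)
  next
    fix i j b g
    assume "i \<noteq> j" "g \<in> ?Gs" "i \<in> g" "j \<in> g" "b \<in> ?Bs"
    then show "\<not> (i \<in> b \<and> j \<in> b)" by (auto simp: line_def)
  next
    fix i j assume ij: "i \<in> S" "j \<in> S" and ne: "\<not> (\<exists>g \<in> ?Gs. i \<in> g \<and> j \<in> g)"
    obtain c x d y where c: "i = (c, x)" "j = (d, y)" by fastforce
    have cd: "c < 5" "d < 5" "x < m" "y < m"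
      using ij n_le[of c] n_le[of d] by (auto simp: S_def c)
    have "c \<noteq> d" using ij ne by (auto simp: S_def c)
    then obtain a b where ab: "a < m" "b < m" "(a + c * b) mod m = x" "(a + d * b) mod m = y"
      using lines_surj[OF m cd(1,2) _ cd(3,4)] by blast
    have uniq: "a' = a \<and> b' = b" if "a' < m" "b' < m" "(a' + c * b') mod m = x" "(a' + d * b') mod m = y" for a' b'
      using lines_inj[OF m cd(1,2), of a' b' a b] lines_inj[OF m cd(2,1), of a' b' a b] ab that \<open>c \<noteq> d\<close>
      by (cases "c < d") auto
    have mem: "i \<in> line a' b' \<and> j \<in> line a' b' \<longleftrightarrow> (a' + c * b') mod m = x \<and> (a' + d * b') mod m = y" for a' b'
      using ij cd by (auto simp: line_def c)
    show "\<exists>!b. b \<in> ?Bs \<and> i \<in> b \<and> j \<in> b"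
    proof (rule ex1I[of _ "line a b"])
      show "line a b \<in> ?Bs \<and> i \<in> line a b \<and> j \<in> line a b"
        using mem[of a b] ab by (auto intro!: image_eqI[of _ _ "(a, b)"])
      fix l assume l: "l \<in> ?Bs \<and> i \<in> l \<and> j \<in> l"
      then obtain a' b' where "a' < m" "b' < m" "l = line a' b'" by auto
      then show "l = line a b" using l mem[of a' b'] uniq[of a' b'] by simp
    qed
  qed auto
  also have "card S = 4 * m + u"
    by (simp add: S_def n_def eval_nat_numeral)
  finally show ?thesis .
qed

section \<open>The recursion on t\<close>

lemma nestable_starters:
  assumes "t \<in> set (map (\<lambda>(K, e, T). length T) starters)" "t \<noteq> 0"
  shows "nestable t"
proof -
  obtain K e T where "(K, e, T) \<in> set starters" "t = length T"
    using assms(1) by auto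
  then show ?thesis
    using starters_ok assms(2) by (auto simp: list_all_iff intro: starter_nestable)
qed

text \<open>These are the positive values not reached by \<open>truncation_exists\<close>.\<close>

lemma starter_sizes: "map (\<lambda>(K, e, T). length T) starters = [1..<20] @ [26, 27] @ [36..<44] @ [66, 67]"
  by code_simp

lemma coprime_6_iff: "coprime m 6 \<longleftrightarrow> odd m \<and> m mod 3 \<noteq> 0" for m :: nat
proof -
  have "coprime m 3 \<longleftrightarrow> \<not> 3 dvd m"
    using prime_imp_coprime[of 3 m] coprime_absorb_left[of 3 m] by (auto simp: coprime_commute)
  then show ?thesis
    using coprime_mult_right_iff[of m 2 3] by (simp add: dvd_eq_mod_eq_0)
qed

lemma coprime_6_add: "coprime (6 * k + 1) (6::nat)" "coprime (6 * k + 5) (6::nat)"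
  unfolding coprime_6_iff by presburger+

text \<open>The intervals from \<open>4 * m\<close> to \<open>5 * m\<close> for \<open>m\<close> =
  5, 7, 11, 13 leave the gaps 26 to 27, 36 to 43 and 66 to 67. From \<open>m = 17\<close> on, that
  is from 68 on, they leave no gap, because consecutive numbers coprime to 6 differ by at most
  4.\<close>

lemma truncation_exists:
  fixes t :: nat
  assumes "t \<ge> 20" "t \<notin> {26, 27} \<union> {36..43} \<union> {66, 67}"
  shows "\<exists>m. coprime m 6 \<and> 4 * m \<le> t \<and> t \<le> 5 * m"
proof -
  consider "t \<in> {20..25}" | "t \<in> {28..35}" | "t \<in> {44..55}" | "t \<in> {52..65}" | "t \<ge> 68"
    using assms by fastforce
  then show ?thesis
  proof cases
    case 1 then show ?thesis by (intro exI[of _ 5]) (auto simp: coprime_6_iff)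
  next
    case 2 then show ?thesis by (intro exI[of _ 7]) (auto simp: coprime_6_iff)
  next
    case 3 then show ?thesis by (intro exI[of _ 11]) (auto simp: coprime_6_iff)
  next
    case 4 then show ?thesis by (intro exI[of _ 13]) (auto simp: coprime_6_iff)
  next
    case 5
    \<comment> \<open>Multiplied by 4, the numbers coprime to 6 are those congruent to 4 or 20
      modulo 24. The cases on \<open>r\<close> select the largest \<open>m\<close> with
      \<open>4 * m\<close> at most \<open>t\<close>.\<close>
    define q r where "q = t div 24" and "r = t mod 24"
    have t: "t = 24 * q + r" "r < 24" by (simp_all add: q_def r_def)
    consider "r < 4" | "4 \<le> r" "r < 20" | "20 \<le> r" by linarith
    then show ?thesis
    proof cases
      case 1
      then have "q \<ge> 1" using 5 t by linarith
      then obtain p where "q = p + 1" using le_Suc_ex by (metis add.commute)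
      with 1 have "4 * (6 * p + 5) \<le> t" "t \<le> 5 * (6 * p + 5)" using 5 t by arith+
      then show ?thesis using coprime_6_add by blast
    next
      case 2
      then have "4 * (6 * q + 1) \<le> t" "t \<le> 5 * (6 * q + 1)" using 5 t by arith+
      then show ?thesis using coprime_6_add by blast
    next
      case 3
      then have "4 * (6 * q + 5) \<le> t" "t \<le> 5 * (6 * q + 5)" using t by arith+
      then show ?thesis using coprime_6_add by blast
    qed
  qed
qed

lemma nestable_all: "nestable t"
proof (induction t rule: less_induct)
  case (less t)
  show ?case
  proof (cases "t = 0")
    case True
    \<comment> \<open>The empty design, which fills the last group when it is truncated to nothing,
      as for \<open>t = 20\<close>.\<close>
    then show ?thesis by (intro nestableI[of "{}" "{}" "[]"]) (auto simp: nested_def)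
  next
    case False
    show ?thesis
    proof (cases "t \<in> {1..<20} \<union> {26, 27} \<union> {36..<44} \<union> {66, 67}")
      case True
      then show ?thesis
        using \<open>t \<noteq> 0\<close> by (intro nestable_starters) (auto simp: starter_sizes)
    next
      case False
      then obtain m where m: "coprime m 6" "4 * m \<le> t" "t \<le> 5 * m"
        using truncation_exists[of t] \<open>t \<noteq> 0\<close> by force
      define u where "u = t - 4 * m"
      \<comment> \<open>Since \<open>t\<close> is positive and at most \<open>5 * m\<close>, also
        \<open>m\<close> is positive, so both \<open>m\<close> and \<open>u\<close> are smaller than
        \<open>t\<close>.\<close>
      have "t = 4 * m + u" "u \<le> m" "m < t" "u < t"
        using m \<open>t \<noteq> 0\<close> by (auto simp: u_def)
      then show ?thesis
        using nestable_truncated_td[OF m(1) \<open>u \<le> m\<close>] less by simp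
    qed
  qed
qed

theorem theorem3p4:
  fixes t :: nat
  assumes "t \<ge> 1" and "t \<noteq> 3" and "t \<noteq> 6"
  shows "(\<exists>(X :: nat set) B Y phi. bibd X B (6 * t) 3 2 \<and>
            weak_nesting X B 3 2 Y phi \<and> card Y = 7 * t)
       \<and> (\<forall>(X :: 'a set) B Y phi. bibd X B (6 * t) 3 2 \<and> weak_nesting X B 3 2 Y phi
            \<longrightarrow> card Y \<ge> 7 * t)"
proof
  \<comment> \<open>Initial segments of the natural numbers of the right sizes serve as
    \<open>X\<close> and \<open>Y\<close>.\<close>
  obtain L where "nested {..<6 * t} {..<7 * t} L"
    using nestableD[OF nestable_all, of "{..<6 * t}" "{..<7 * t}" t] by auto
  then show "\<exists>(X :: nat set) B Y phi. bibd X B (6 * t) 3 2 \<and> weak_nesting X B 3 2 Y phi \<and> card Y = 7 * t"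
    using nested_weak_nesting[of "{..<6 * t}" "{..<7 * t}" L] by fastforce
qed (use weak_nesting_card_ge in blast)

end
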